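(* Let $C\subset\mathbb{R}^2$ be a circle centered at the origin $(0,0)$, let $\mathbf{x}_0$ be a point of $C$ lying on the $x$-axis, and let $U$ be an open neighborhood of $C$ with $C\subset U\subset \mathbb{R}^2\setminus\{(0,0)\}$. Let $a>0$ and let $g:U\times(-a,a)\to\mathbb{R}^2$ be continuous and such that (i) $g(\mathbf{r},0)=-\dfrac{\kappa}{\|\mathbf{r}\|^{\alpha+2}}\,\mathbf{r}$ for all $\mathbf{r}=(x,y)\in U$, where $\kappa>0$, $\alpha\ge 0$ and $\alpha\neq 1$ are constants; (ii) for each $\mu\in(-a,a)$, the map $\mathbf{r}\mapsto g(\mathbf{r},\mu)$ is $C^1$ on $U$; (iii) for all $\mu\in(-a,a)$, $g(\cdot,\mu)$ is invariant (as a vector field) under the reflection $\varphi(x,y)=(x,-y)$; that is, $\varphi(U)=U$ and $g(\varphi(\mathbf{r}),\mu)=\varphi(g(\mathbf{r},\mu))$ for all $\mathbf{r}\in U$. Then one can choose $\delta_0$ with $0<\delta_0<a$ such that for each $\mu\in(-\delta_0,\delta_0)$ there is $\mathbf{v}_\mu\in\mathbb{R}^2$ for which $\mathbf{r}(t,\mathbf{x}_0,\mathbf{v}_\mu,\mu)$ is periodic, and such that, moreover, there is a compact connected set $\mathcal{V}\subset\mathbb{R}^2\times(-a,a)\subset\mathbb{R}^2\times\mathbb{R}$ with the following properties: 1) $\mathcal{V}_\mu:=\mathcal{V}\cap(\mathbb{R}^2\times\{\mu\})\neq\emptyset$ for all $\mu\in[0,\delta_0]$; 2) for every $(\mathbf{v},\mu)\in\mathcal{V}$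 the solution $\mathbf{r}(t,\mathbf{x}_0,\mathbf{v},\mu)$ of $\ddot{\mathbf{r}}=g(\mathbf{r},\mu)$ is periodic, and its trace is a simple closed curve which is symmetric with respect to the $x$-axis and encloses the origin.
   Context: $\mathbf{r}(t,\mathbf{x},\mathbf{v},\mu)$ denotes the solution of the second order ODE $\ddot{\mathbf{r}}=g(\mathbf{r},\mu)$ with initial conditions $\mathbf{r}(0,\mathbf{x},\mathbf{v},\mu)=\mathbf{x}$ and $\dot{\mathbf{r}}(0,\mathbf{x},\mathbf{v},\mu)=\mathbf{v}$. The trace of a solution is its image in $\mathbb{R}^2$. A simple closed curve $S\subset\mathbb{R}^2$ encloses a point $p\notin S$ if $p$ belongs to the bounded component of $\mathbb{R}^2\setminus S$. *)

theory Defs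
  imports "HOL-Analysis.Analysis"
begin

definition reflect_x :: "real^2 \<Rightarrow> real^2" where
  "reflect_x p = vector [p $ 1, - (p $ 2)]"

definition C1_on :: "('a::real_normed_vector \<Rightarrow> 'b::real_normed_vector) \<Rightarrow> 'a set \<Rightarrow> bool" where
  "C1_on f U \<longleftrightarrow>
     (\<exists>f' :: 'a \<Rightarrow> 'a \<Rightarrow>\<^sub>L 'b.
        (\<forall>p\<in>U. (f has_derivative blinfun_apply (f' p)) (at p)) \<and> continuous_on U f')"

(* r is the solution, defined for all times and staying in U, of r'' = f(r) with r(0) = x and
   r'(0) = v. A periodic solution is defined on the whole real line, so solutions with a smaller
   interval of existence are not needed here. If f is C^1 on the open set U then r is uniquely
   determined by (x, v), so "the solution satisfies P" can be written as "EX r. global_solution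
   f U x v r & P r". *)
definition global_solution ::
  "(real^2 \<Rightarrow> real^2) \<Rightarrow> (real^2) set \<Rightarrow> real^2 \<Rightarrow> real^2 \<Rightarrow> (real \<Rightarrow> real^2) \<Rightarrow> bool" where
  "global_solution f U x v r \<longleftrightarrow>
     (\<forall>t. r t \<in> U) \<and> r 0 = x \<and>
     (\<exists>w. w 0 = v \<and>
        (\<forall>t. (r has_vector_derivative w t) (at t) \<and>
             (w has_vector_derivative f (r t)) (at t)))"

definition periodic :: "(real \<Rightarrow> 'a) \<Rightarrow> bool" where
  "periodic r \<longleftrightarrow> (\<exists>T>0. \<forall>t. r (t + T) = r t)"

definition simple_closed_curve :: "'a::topological_space set \<Rightarrow> bool" where
  "simple_closed_curve S \<longleftrightarrow>
     (\<exists>c. simple_path c \<and> pathfinish c = pathstart c \<and> path_image c = S)"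

(* The library's inside S consists of the points outside S whose connected component in the
   complement of S is bounded. *)
definition encloses :: "(real^2) set \<Rightarrow> real^2 \<Rightarrow> bool" where
  "encloses S p \<longleftrightarrow> p \<in> inside S"

end

theory Submission
  imports Defs
begin

text \<open>
  Let \<theta> be the polar angle. A solution that winds around the origin without stopping can be
  described by its orbit, that is by \<open>u = 1 / \<parallel>r\<parallel>\<close>, \<open>q = du/d\<theta>\<close> and \<open>N = 1 / L\<^sup>2\<close>, where \<open>L\<close> is the
  angular momentum; these three functions of \<theta> satisfy a nonautonomous first order system
  (\<open>orbit_field\<close>) that is Binet's equation for a force that need not be central. The angle as
  independent variable turns the less convenient ``first return to the axis'' into the evaluation at
  \<open>\<theta> = \<pi>\<close>, and it makes every periodic orbit visibly a curve that is star-shaped about the origin.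

  Start on the axis perpendicularly to it, that is with \<open>q 0 = 0\<close>, and let \<open>shoot N \<mu>\<close> be \<open>q \<pi>\<close>. If
  \<open>shoot N \<mu> = 0\<close> then the orbit meets the axis perpendicularly again, and the reflection symmetry
  continues it to an even, \<open>2 \<pi>\<close>-periodic function of \<theta> (\<open>reversible_solution\<close>). Undoing the change of
  the independent variable gives a periodic solution of the second order equation (\<open>orbit_to_solution\<close>)
  whose trace is a symmetric simple closed curve around the origin. So only zeros of \<open>shoot\<close> are needed.

  For \<open>\<mu> = 0\<close> the circular orbit is an equilibrium of the orbit equation, which there reads
  \<open>u'' + u = \<kappa> N u\<^bsup>\<alpha>-1\<^esup>\<close>, \<open>N' = 0\<close>. Its linearisation, excited by a change of \<open>N\<close>, is the forced
  oscillator \<open>Y'' + (2 - \<alpha>) Y = c\<close>, for which \<open>Y' \<pi>\<close> is a multiple of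
  \<open>sin (\<pi> \<surd>(2 - \<alpha>)) / \<surd>(2 - \<alpha>)\<close> (a \<open>sinh\<close> quotient for \<open>\<alpha> > 2\<close>, and \<pi> for \<open>\<alpha> = 2\<close>).
  For \<open>\<alpha> \<ge> 0\<close> it vanishes only at \<open>\<alpha> = 1\<close>, the Kepler problem, where all nearby orbits are closed
  ellipses. Hence \<open>shoot N 0\<close> changes sign at the circular orbit (\<open>shoot_changes_sign\<close>).

  The field is continuous in \<mu> and Lipschitz for each single \<mu>, which suffices for the
  continuity of \<open>shoot\<close> because Gronwall's inequality needs the Lipschitz constant of only one of the two
  fields it compares. So the opposite signs at the two ends of a small interval of \<open>N\<close> persist for small \<mu>.
  The intermediate value theorem gives a zero for each such \<mu>; that the zeros over \<open>[0, \<delta>\<^sub>0]\<close> contain a continuum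
  reaching from one end to the other is a topological fact about rectangles
  (\<open>zero_continuum\<close>), which follows from Brouwer's fixed point theorem.
\<close>

section \<open>Differential equations with a globally Lipschitz right-hand side\<close>

text \<open>
  The square of the norm is differentiable where the norm itself is not, and
  \<open>2 \<epsilon> \<parallel>d\<parallel> \<le> \<parallel>d\<parallel>\<^sup>2 + \<epsilon>\<^sup>2\<close> turns the inequality for \<open>d\<close> into a linear one for \<open>\<parallel>d\<parallel>\<^sup>2\<close>.
\<close>

lemma gronwall_norm_sq:
  fixes d :: "real \<Rightarrow> 'a::real_inner"
  assumes deriv: "\<And>s. s \<in> {0..T} \<Longrightarrow> (d has_vector_derivative d' s) (at s)"
    and bound: "\<And>s. s \<in> {0..T} \<Longrightarrow> norm (d' s) \<le> K * norm (d s) + \<epsilon>"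
    and "0 \<le> K" "t \<in> {0..T}"
  shows "(norm (d t))\<^sup>2 \<le> ((norm (d 0))\<^sup>2 + \<epsilon>\<^sup>2 * t) * exp ((2 * K + 1) * t)"
proof -
  define c where "c = 2 * K + 1"
  define \<phi> where "\<phi> s = (d s \<bullet> d s) * exp (- c * s) - \<epsilon>\<^sup>2 * s" for s
  have "\<phi> 0 \<ge> \<phi> t"
  proof (rule DERIV_nonpos_imp_nonincreasing[of 0 t \<phi>])
    show "0 \<le> t" using assms by simp
    fix s assume "0 \<le> s" "s \<le> t"
    then have s: "s \<in> {0..T}" using assms by simp
    have sq: "((\<lambda>s. d s \<bullet> d s) has_real_derivative 2 * (d s \<bullet> d' s)) (at s)"
      unfolding has_real_derivative_iff_has_vector_derivative has_vector_derivative_def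
      by (rule derivative_eq_intros deriv[OF s, unfolded has_vector_derivative_def] refl)+
        (auto simp: inner_commute algebra_simps)
    have der: "(\<phi> has_real_derivative
        (2 * (d s \<bullet> d' s) - c * (d s \<bullet> d s)) * exp (- c * s) - \<epsilon>\<^sup>2) (at s)"
      unfolding \<phi>_def by (rule derivative_eq_intros sq refl)+ (simp add: algebra_simps)
    have "d s \<bullet> d' s \<le> norm (d s) * (K * norm (d s) + \<epsilon>)"
      using norm_cauchy_schwarz[of "d s" "d' s"] mult_left_mono[OF bound[OF s] norm_ge_zero[of "d s"]]
      by linarith
    moreover have "2 * (norm (d s) * \<epsilon>) \<le> (norm (d s))\<^sup>2 + \<epsilon>\<^sup>2"
      using sum_squares_bound[of "norm (d s)" \<epsilon>] by simp
    ultimately have "2 * (d s \<bullet> d' s) - c * (d s \<bullet> d s) \<le> \<epsilon>\<^sup>2"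
      unfolding c_def by (simp add: power2_norm_eq_inner[symmetric] power2_eq_square algebra_simps)
    then have "(2 * (d s \<bullet> d' s) - c * (d s \<bullet> d s)) * exp (- c * s) \<le> \<epsilon>\<^sup>2 * exp (- c * s)"
      by (rule mult_right_mono) simp
    also have "\<dots> \<le> \<epsilon>\<^sup>2 * 1"
    proof (intro mult_left_mono)
      have "0 \<le> c * s" using \<open>0 \<le> s\<close> \<open>0 \<le> K\<close> by (simp add: c_def)
      then show "exp (- c * s) \<le> 1" by simp
    qed simp
    finally show "\<exists>y. DERIV \<phi> s :> y \<and> y \<le> 0" using der by auto
  qed
  then have "(norm (d t))\<^sup>2 * exp (- c * t) \<le> (norm (d 0))\<^sup>2 + \<epsilon>\<^sup>2 * t"
    by (simp add: \<phi>_def power2_norm_eq_inner)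
  then have "(norm (d t))\<^sup>2 * exp (- c * t) * exp (c * t)
      \<le> ((norm (d 0))\<^sup>2 + \<epsilon>\<^sup>2 * t) * exp (c * t)"
    by (rule mult_right_mono) simp
  moreover have "exp (- c * t) * exp (c * t) = 1" by (simp add: exp_add[symmetric])
  ultimately show ?thesis unfolding c_def[symmetric] by (simp only: mult.assoc mult_1_right)
qed

text \<open>
  The constant is far from optimal; all that matters below is that it depends only on \<open>T\<close> and \<open>K\<close>
  and that the bound is linear in \<open>\<parallel>d 0\<parallel> + \<epsilon>\<close>.
\<close>

lemma gronwall_norm:
  fixes d :: "real \<Rightarrow> 'a::real_inner"
  assumes deriv: "\<And>s. s \<in> {0..T} \<Longrightarrow> (d has_vector_derivative d' s) (at s)"
    and bound: "\<And>s. s \<in> {0..T} \<Longrightarrow> norm (d' s) \<le> K * norm (d s) + \<epsilon>"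
    and "0 \<le> K" "0 \<le> \<epsilon>" "t \<in> {0..T}"
  shows "norm (d t) \<le> (norm (d 0) + \<epsilon>) * ((1 + T) * exp ((2 * K + 1) * T))"
proof (rule power2_le_imp_le)
  define E where "E = (1 + T) * exp ((2 * K + 1) * T)"
  have T: "0 \<le> t" "t \<le> T" "0 \<le> T" using assms by auto
  have E1: "1 \<le> E"
    unfolding E_def using mult_mono[of 1 "1+T" 1 "exp ((2 * K + 1) * T)"] T \<open>0 \<le> K\<close> by simp
  have "(norm (d t))\<^sup>2 \<le> ((norm (d 0))\<^sup>2 + \<epsilon>\<^sup>2 * t) * exp ((2 * K + 1) * t)"
    using gronwall_norm_sq[OF deriv bound \<open>0 \<le> K\<close> \<open>t \<in> {0..T}\<close>] .
  also have "\<dots> \<le> ((norm (d 0) + \<epsilon>)\<^sup>2 * (1 + T)) * exp ((2 * K + 1) * T)"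
  proof (intro mult_mono)
    have "\<epsilon>\<^sup>2 * t \<le> (norm (d 0) + \<epsilon>)\<^sup>2 * T"
      using T \<open>0 \<le> \<epsilon>\<close> by (intro mult_mono power_mono) auto
    moreover have "(norm (d 0))\<^sup>2 \<le> (norm (d 0) + \<epsilon>)\<^sup>2"
      using \<open>0 \<le> \<epsilon>\<close> by (intro power_mono) auto
    ultimately show "(norm (d 0))\<^sup>2 + \<epsilon>\<^sup>2 * t \<le> (norm (d 0) + \<epsilon>)\<^sup>2 * (1 + T)"
      by (simp add: algebra_simps)
    show "exp ((2 * K + 1) * t) \<le> exp ((2 * K + 1) * T)"
      using T \<open>0 \<le> K\<close> by (simp add: mult_left_mono)
  qed (use T in auto)
  also have "\<dots> = (norm (d 0) + \<epsilon>)\<^sup>2 * E" by (simp add: E_def)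
  also have "\<dots> \<le> (norm (d 0) + \<epsilon>)\<^sup>2 * E\<^sup>2"
    using E1 by (intro mult_left_mono) (auto simp: power2_eq_square)
  finally show "(norm (d t))\<^sup>2 \<le> ((norm (d 0) + \<epsilon>) * E)\<^sup>2" by (simp add: power_mult_distrib)
  show "0 \<le> (norm (d 0) + \<epsilon>) * E" using E1 \<open>0 \<le> \<epsilon>\<close> by simp
qed

lemma has_vector_derivative_affine_arg:
  fixes f :: "real \<Rightarrow> 'a::real_normed_vector"
  assumes "(f has_vector_derivative f') (at (a + c * s))"
  shows "((\<lambda>s. f (a + c * s)) has_vector_derivative c *\<^sub>R f') (at s)"
proof -
  have "((\<lambda>s. a + c * s) has_vector_derivative c) (at s)"
    by (auto intro!: derivative_eq_intros)
  from vector_diff_chain_at[OF this assms] show ?thesis by (simp add: o_def)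
qed

lemma norm_le_exp_growth:
  fixes f :: "real \<Rightarrow> 'a::real_normed_vector"
  assumes deriv: "\<And>s. (f has_vector_derivative f' s) (at s)" and "f 0 = 0"
    and bound: "\<And>s. norm (f' s) \<le> B * exp (l * \<bar>s\<bar>)" and "0 < l" "0 \<le> B"
  shows "norm (f t) \<le> B / l * exp (l * \<bar>t\<bar>)"
proof -
  have pos: "norm (h t) \<le> B / l * exp (l * t)"
    if "0 \<le> t" and h: "\<And>s. (h has_vector_derivative h' s) (at s)" "h 0 = 0"
      "\<And>s. norm (h' s) \<le> B * exp (l * \<bar>s\<bar>)" for h h' :: "real \<Rightarrow> 'a" and t
  proof (cases "t = 0")
    case True
    then show ?thesis using h assms by simp
  next
    case False
    then have "0 < t" using that by simp
    have "norm (h t - h 0) \<le> B / l * exp (l * t) - B / l * exp (l * 0)"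
    proof (rule differentiable_bound_general[OF \<open>0 < t\<close>])
      show "continuous_on {0..t} h"
        using h(1) by (meson continuous_at_imp_continuous_on has_vector_derivative_continuous)
      show "((\<lambda>s. B / l * exp (l * s)) has_vector_derivative B * exp (l * s)) (at s)" for s
        unfolding has_real_derivative_iff_has_vector_derivative[symmetric]
        using \<open>0 < l\<close> by (auto intro!: derivative_eq_intros)
      show "norm (h' s) \<le> B * exp (l * s)" if "0 < s" for s using h(3)[of s] that by simp
    qed (use \<open>0 < l\<close> in \<open>auto intro!: continuous_intros h\<close>)
    moreover have "0 \<le> B / l" using assms by simp
    ultimately show ?thesis using h by simp
  qed
  show ?thesis
  proof (cases "0 \<le> t")
    case True
    then show ?thesis using pos[OF True deriv \<open>f 0 = 0\<close> bound] by simp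
  next
    case False
    have "((\<lambda>s. f (- s)) has_vector_derivative - f' (- s)) (at s)" for s
      using has_vector_derivative_affine_arg[of f "f' (- s)" 0 "-1" s] deriv[of "- s"] by simp
    then show ?thesis using pos[of "- t" "\<lambda>s. f (- s)" "\<lambda>s. - f' (- s)"] False bound \<open>f 0 = 0\<close>
      by (simp add: bound) (metis abs_minus_cancel bound)
  qed
qed

lemma antiderivative_real:
  fixes f :: "real \<Rightarrow> 'a::euclidean_space"
  assumes "continuous_on UNIV f"
  shows "\<exists>G. G 0 = 0 \<and> (\<forall>x. (G has_vector_derivative f x) (at x))"
proof -
  obtain G where "(G has_vector_derivative f x) (at x)" for x
    using einterval_antiderivative[of "-\<infinity>" "\<infinity>" f] assms
    by (auto simp: continuous_on_eq_continuous_at)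
  then show ?thesis by (intro exI[of _ "\<lambda>x. G x - G 0"]) (auto intro!: derivative_eq_intros)
qed

text \<open>
  Picard's operator is a contraction on all of the line at once in the weighted norm
  \<open>sup e\<^bsup>-l|t|\<^esup> \<parallel>z t\<parallel>\<close> with \<open>l > K\<close>, so no solutions on small intervals have to be glued together.
\<close>

lemma global_existence:
  fixes F :: "real \<Rightarrow> 'a::euclidean_space \<Rightarrow> 'a"
  assumes cont: "continuous_on UNIV (\<lambda>(t, z). F t z)"
    and lip: "\<And>t x y. norm (F t x - F t y) \<le> K * norm (x - y)"
    and bnd: "\<And>t x. norm (F t x) \<le> M" and "0 \<le> K"
  obtains z where "z 0 = z0" "\<And>t. (z has_vector_derivative F t (z t)) (at t)"
proof -
  define l where "l = K + 1"
  have l: "0 < l" "1 \<le> l" using \<open>0 \<le> K\<close> by (auto simp: l_def)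
  have "0 \<le> M" by (rule order_trans[OF norm_ge_zero bnd])
  define P :: "(real \<Rightarrow> 'a) \<Rightarrow> real \<Rightarrow> 'a" where
    "P f = (SOME G. G 0 = 0 \<and> (\<forall>x. (G has_vector_derivative f x) (at x)))" for f
  have P: "P f 0 = 0 \<and> (\<forall>x. (P f has_vector_derivative f x) (at x))" if *: "continuous_on UNIV f" for f
    using someI_ex[OF antiderivative_real[OF *]] unfolding P_def .
  define f where "f y s = F s (exp (l * \<bar>s\<bar>) *\<^sub>R apply_bcontfun y s)" for y :: "real \<Rightarrow>\<^sub>C 'a" and s
  have f: "continuous_on UNIV (f y)" for y
  proof -
    have "continuous_on UNIV (\<lambda>s. (s, exp (l * \<bar>s\<bar>) *\<^sub>R apply_bcontfun y s))"
      by (intro continuous_intros continuous_on_apply_bcontfun)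
    from continuous_on_compose2[OF cont this] show ?thesis by (simp add: f_def)
  qed
  have Pf: "P (f y) 0 = 0" "\<And>x. (P (f y) has_vector_derivative f y x) (at x)" for y
    using P[OF f] by auto
  define Q where "Q y t = exp (- (l * \<bar>t\<bar>)) *\<^sub>R (z0 + P (f y) t)" for y t
  have Q: "Q y \<in> bcontfun" for y
  proof (rule bcontfun_normI)
    have "continuous_on UNIV (P (f y))"
      using Pf by (meson continuous_at_imp_continuous_on has_vector_derivative_continuous)
    then show "continuous_on UNIV (Q y)"
      unfolding Q_def by (intro continuous_intros)
    show "norm (Q y t) \<le> norm z0 + M / l" for t
    proof -
      have "norm (P (f y) t) \<le> M / l * exp (l * \<bar>t\<bar>)"
      proof (rule norm_le_exp_growth[OF Pf(2) Pf(1)])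
        show "norm (f y s) \<le> M * exp (l * \<bar>s\<bar>)" for s
          using bnd[of s "exp (l * \<bar>s\<bar>) *\<^sub>R apply_bcontfun y s"]
            mult_left_mono[of 1 "exp (l * \<bar>s\<bar>)" M] l \<open>0 \<le> M\<close>
          unfolding f_def by simp
      qed (use l \<open>0 \<le> M\<close> in auto)
      moreover have "norm z0 \<le> norm z0 * exp (l * \<bar>t\<bar>)"
        using mult_left_mono[of 1 "exp (l * \<bar>t\<bar>)" "norm z0"] l by simp
      ultimately have "norm (z0 + P (f y) t) \<le> (norm z0 + M / l) * exp (l * \<bar>t\<bar>)"
        using norm_triangle_ineq[of z0 "P (f y) t"] by (simp add: algebra_simps)
      then have "exp (- (l * \<bar>t\<bar>)) * norm (z0 + P (f y) t)
          \<le> exp (- (l * \<bar>t\<bar>)) * ((norm z0 + M / l) * exp (l * \<bar>t\<bar>))"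
        by (rule mult_left_mono) simp
      moreover have "exp (- (l * \<bar>t\<bar>)) * ((norm z0 + M / l) * exp (l * \<bar>t\<bar>)) = norm z0 + M / l"
        by (simp add: exp_minus field_simps)
      ultimately show ?thesis by (simp add: Q_def)
    qed
  qed
  have app: "apply_bcontfun (Bcontfun (Q y)) = Q y" for y
    using Q by (simp add: Bcontfun_inverse)
  have "\<exists>!y. Bcontfun (Q y) = y"
  proof (rule banach_fix_type[of "K / l"])
    show "0 \<le> K / l" "K / l < 1" using \<open>0 \<le> K\<close> by (auto simp: l_def)
    show "\<forall>x y. dist (Bcontfun (Q x)) (Bcontfun (Q y)) \<le> K / l * dist x y"
    proof (intro allI dist_bound)
      fix x y :: "real \<Rightarrow>\<^sub>C 'a" and t
      have "norm (P (f x) t - P (f y) t) \<le> (K * dist x y) / l * exp (l * \<bar>t\<bar>)"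
      proof (rule norm_le_exp_growth)
        show "((\<lambda>t. P (f x) t - P (f y) t) has_vector_derivative f x s - f y s) (at s)" for s
          by (intro derivative_intros Pf)
        show "norm (f x s - f y s) \<le> K * dist x y * exp (l * \<bar>s\<bar>)" for s
        proof -
          have "norm (f x s - f y s) \<le> K * norm (exp (l * \<bar>s\<bar>) *\<^sub>R apply_bcontfun x s
              - exp (l * \<bar>s\<bar>) *\<^sub>R apply_bcontfun y s)"
            unfolding f_def by (rule lip)
          also have "\<dots> = K * (exp (l * \<bar>s\<bar>) * dist (apply_bcontfun x s) (apply_bcontfun y s))"
            by (simp add: dist_norm flip: scaleR_diff_right)
          also have "\<dots> \<le> K * (exp (l * \<bar>s\<bar>) * dist x y)"
            using \<open>0 \<le> K\<close> by (intro mult_left_mono dist_bounded) auto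
          finally show ?thesis by (simp add: mult_ac)
        qed
      qed (use l \<open>0 \<le> K\<close> Pf in auto)
      then have "exp (- (l * \<bar>t\<bar>)) * norm (P (f x) t - P (f y) t)
          \<le> exp (- (l * \<bar>t\<bar>)) * ((K * dist x y) / l * exp (l * \<bar>t\<bar>))"
        by (rule mult_left_mono) simp
      also have "\<dots> = K / l * dist x y" by (simp add: exp_minus field_simps)
      finally show "dist (apply_bcontfun (Bcontfun (Q x)) t) (apply_bcontfun (Bcontfun (Q y)) t)
          \<le> K / l * dist x y"
        by (simp add: app Q_def dist_norm flip: scaleR_diff_right)
    qed
  qed
  then obtain y where y: "Bcontfun (Q y) = y" by auto
  define z where "z t = z0 + P (f y) t" for t
  have zy: "exp (l * \<bar>t\<bar>) *\<^sub>R apply_bcontfun y t = z t" for t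
  proof -
    have "apply_bcontfun y t = Q y t" using app[of y] y by simp
    then show ?thesis by (simp add: Q_def z_def exp_minus)
  qed
  show ?thesis
  proof
    show "z 0 = z0" by (simp add: z_def Pf)
    have "(z has_vector_derivative f y t) (at t)" for t
      unfolding z_def by (auto intro!: derivative_eq_intros Pf)
    then show "(z has_vector_derivative F t (z t)) (at t)" for t
      by (simp add: f_def zy)
  qed
qed

lemma ode_unique:
  fixes F :: "real \<Rightarrow> 'a::real_inner \<Rightarrow> 'a"
  assumes lip: "\<And>t x y. norm (F t x - F t y) \<le> K * norm (x - y)" and "0 \<le> K"
    and x: "\<And>t. (x has_vector_derivative F t (x t)) (at t)"
    and y: "\<And>t. (y has_vector_derivative F t (y t)) (at t)"
    and "x t0 = y t0"
  shows "x t = y t"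
proof -
  have fwd: "norm (d s) \<le> 0" if d: "\<And>s. (d has_vector_derivative d' s) (at s)"
    "\<And>s. norm (d' s) \<le> K * norm (d s)" "d 0 = 0" "0 \<le> s" for d d' :: "real \<Rightarrow> 'a" and s
    using gronwall_norm[of s d d' K 0 s] d \<open>0 \<le> K\<close> by auto
  define d where "d s = x s - y s" for s
  have der: "(d has_vector_derivative F s (x s) - F s (y s)) (at s)" for s
    unfolding d_def by (intro derivative_intros x y)
  have p: "norm (d (t0 + s)) \<le> 0" if "0 \<le> s" for s
  proof (rule fwd[where s = s])
    show "((\<lambda>s. d (t0 + s)) has_vector_derivative F (t0 + s) (x (t0 + s)) - F (t0 + s) (y (t0 + s))) (at s)" for s
      using has_vector_derivative_affine_arg[of d _ t0 1 s] der[of "t0 + s"] by simp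
  qed (use lip assms that in \<open>auto simp: d_def\<close>)
  have m: "norm (d (t0 - s)) \<le> 0" if "0 \<le> s" for s
  proof (rule fwd[where s = s])
    show "((\<lambda>s. d (t0 - s)) has_vector_derivative - (F (t0 - s) (x (t0 - s)) - F (t0 - s) (y (t0 - s)))) (at s)" for s
      using has_vector_derivative_affine_arg[of d "F (t0 - s) (x (t0 - s)) - F (t0 - s) (y (t0 - s))" t0 "-1" s]
        der[of "t0 - s"] by simp
    show "norm (- (F (t0 - s) (x (t0 - s)) - F (t0 - s) (y (t0 - s)))) \<le> K * norm (d (t0 - s))" for s
      by (simp only: norm_minus_cancel d_def lip)
  qed (use assms that in \<open>auto simp: d_def\<close>)
  show ?thesis using p[of "t - t0"] m[of "t0 - t"] by (cases "t0 \<le> t") (auto simp: d_def)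
qed

text \<open>
  Only one of the two fields is required to be Lipschitz. A family of fields whose Lipschitz constants
  are not bounded in the parameter can therefore still be handled.
\<close>

lemma ode_dist_bound:
  fixes F G :: "real \<Rightarrow> 'a::real_inner \<Rightarrow> 'a"
  assumes lip: "\<And>t x y. norm (F t x - F t y) \<le> K * norm (x - y)" and "0 \<le> K"
    and x: "\<And>t. (x has_vector_derivative F t (x t)) (at t)"
    and y: "\<And>t. (y has_vector_derivative G t (y t)) (at t)"
    and close: "\<And>t. t \<in> {0..T} \<Longrightarrow> norm (F t (y t) - G t (y t)) \<le> \<epsilon>"
    and t: "t \<in> {0..T}"
  shows "norm (x t - y t) \<le> (norm (x 0 - y 0) + \<epsilon>) * ((1 + T) * exp ((2 * K + 1) * T))"
proof (rule gronwall_norm[where d = "\<lambda>t. x t - y t"])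
  show "((\<lambda>t. x t - y t) has_vector_derivative F s (x s) - G s (y s)) (at s)" for s
    by (intro derivative_intros x y)
  show "norm (F s (x s) - G s (y s)) \<le> K * norm (x s - y s) + \<epsilon>" if "s \<in> {0..T}" for s
    using norm_triangle_ineq[of "F s (x s) - F s (y s)" "F s (y s) - G s (y s)"]
      lip[of s "x s" "y s"] close[OF that] by simp
  show "0 \<le> \<epsilon>" using close[OF t] norm_ge_zero order_trans by blast
qed (use assms in auto)

lemma ode_continuous_dependence:
  fixes F :: "real \<Rightarrow> real \<Rightarrow> 'a::real_inner \<Rightarrow> 'a"
  assumes lip: "\<And>t x y. norm (F \<mu>1 t x - F \<mu>1 t y) \<le> K * norm (x - y)" and "0 \<le> K"
    and unif: "\<And>\<epsilon>. 0 < \<epsilon> \<Longrightarrow> \<exists>\<delta>>0. \<forall>\<mu>\<in>J. \<bar>\<mu> - \<mu>1\<bar> < \<delta> \<longrightarrow>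
      (\<forall>t\<in>{0..T}. \<forall>z. norm (F \<mu>1 t z - F \<mu> t z) \<le> \<epsilon>)"
    and X0: "\<And>\<mu> z. \<mu> \<in> J \<Longrightarrow> X \<mu> z 0 = z"
    and X: "\<And>\<mu> z t. \<mu> \<in> J \<Longrightarrow> (X \<mu> z has_vector_derivative F \<mu> t (X \<mu> z t)) (at t)"
    and "\<mu>1 \<in> J" "0 < \<epsilon>" "0 \<le> T"
  shows "\<exists>\<delta>>0. \<forall>\<mu>\<in>J. \<forall>z. \<bar>\<mu> - \<mu>1\<bar> < \<delta> \<and> norm (z - z1) < \<delta> \<longrightarrow>
    (\<forall>t\<in>{0..T}. norm (X \<mu> z t - X \<mu>1 z1 t) < \<epsilon>)"
proof -
  define E where "E = (1 + T) * exp ((2 * K + 1) * T)"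
  have "0 < E" using \<open>0 \<le> T\<close> by (simp add: E_def)
  \<comment> \<open>half of \<open>\<epsilon> / E\<close> for the initial values and half for the fields\<close>
  define \<eta> where "\<eta> = \<epsilon> / (2 * E)"
  have "0 < \<eta>" using \<open>0 < E\<close> \<open>0 < \<epsilon>\<close> by (simp add: \<eta>_def)
  obtain \<delta> where "0 < \<delta>" and \<delta>: "\<And>\<mu> t z. \<mu> \<in> J \<Longrightarrow> \<bar>\<mu> - \<mu>1\<bar> < \<delta> \<Longrightarrow> t \<in> {0..T} \<Longrightarrow>
      norm (F \<mu>1 t z - F \<mu> t z) \<le> \<eta>"
    using unif[OF \<open>0 < \<eta>\<close>] by blast
  show ?thesis
  proof (intro exI[of _ "min \<delta> \<eta>"] conjI ballI allI impI)
    show "0 < min \<delta> \<eta>" using \<open>0 < \<delta>\<close> \<open>0 < \<eta>\<close> by simp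
    fix \<mu> z t
    assume *: "\<mu> \<in> J" "\<bar>\<mu> - \<mu>1\<bar> < min \<delta> \<eta> \<and> norm (z - z1) < min \<delta> \<eta>" "t \<in> {0..T}"
    have "norm (X \<mu>1 z1 t - X \<mu> z t) \<le> (norm (X \<mu>1 z1 0 - X \<mu> z 0) + \<eta>) * E"
      unfolding E_def
      by (rule ode_dist_bound[where F = "F \<mu>1" and G = "F \<mu>"]) (use * \<delta> lip X \<open>0 \<le> K\<close> \<open>\<mu>1 \<in> J\<close> in auto)
    also have "\<dots> < (\<eta> + \<eta>) * E"
      using * \<open>0 < E\<close> X0 \<open>\<mu>1 \<in> J\<close> by (intro mult_strict_right_mono) (auto simp: norm_minus_commute)
    also have "\<dots> = \<epsilon>" using \<open>0 < E\<close> by (simp add: \<eta>_def)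
    finally show "norm (X \<mu> z t - X \<mu>1 z1 t) < \<epsilon>" by (simp add: norm_minus_commute)
  qed
qed

text \<open>
  The difference \<open>X \<nu> - e - \<nu> Y\<close> starts at 0 and satisfies the linear equation \<open>d' = L d\<close> up to the remainder of
  the derivative of \<open>F\<close>, which is \<open>o(\<nu>)\<close> since \<open>X \<nu>\<close> stays within \<open>O(\<nu>)\<close> of the equilibrium.
\<close>

lemma ode_linearisation_at_equilibrium:
  fixes F :: "'a::real_inner \<Rightarrow> 'a"
  assumes lip: "\<And>x y. norm (F x - F y) \<le> K * norm (x - y)" and "0 \<le> K"
    and "F e = 0" and L: "(F has_derivative L) (at e)"
    and Y: "\<And>t. (Y has_vector_derivative L (Y t)) (at t)"
    and X0: "\<And>\<nu>. X \<nu> 0 = e + \<nu> *\<^sub>R Y 0"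
    and X: "\<And>\<nu> t. (X \<nu> has_vector_derivative F (X \<nu> t)) (at t)"
    and "0 < \<epsilon>" "0 \<le> T"
  shows "\<exists>\<delta>>0. \<forall>\<nu>. \<bar>\<nu>\<bar> < \<delta> \<longrightarrow> (\<forall>t\<in>{0..T}. norm (X \<nu> t - e - \<nu> *\<^sub>R Y t) \<le> \<epsilon> * \<bar>\<nu>\<bar>)"
proof -
  have linL: "bounded_linear L" using L by (rule has_derivative_bounded_linear)
  obtain B where "0 < B" and B: "\<And>x. norm (L x) \<le> norm x * B"
    using bounded_linear.pos_bounded[OF linL] by blast
  define E where "E = (1 + T) * exp ((2 * K + 1) * T)"
  define E' where "E' = (1 + T) * exp ((2 * B + 1) * T)"
  define C where "C = (norm (Y 0) + 1) * E"
  have "0 < E" "0 < E'" using \<open>0 \<le> T\<close> by (auto simp: E_def E'_def)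
  then have "0 < C" unfolding C_def by (intro mult_pos_pos add_nonneg_pos) auto
  define \<eta> where "\<eta> = \<epsilon> / (C * E')"
  have "0 < \<eta>" using \<open>0 < E'\<close> \<open>0 < C\<close> \<open>0 < \<epsilon>\<close> by (simp add: \<eta>_def)
  obtain \<rho> where "0 < \<rho>" and \<rho>: "\<And>y. norm (y - e) < \<rho> \<Longrightarrow>
      norm (F y - F e - L (y - e)) \<le> \<eta> * norm (y - e)"
    using L[unfolded has_derivative_at_alt] \<open>0 < \<eta>\<close> by blast
  show ?thesis
  proof (intro exI[of _ "\<rho> / C"] conjI ballI allI impI)
    show "0 < \<rho> / C" using \<open>0 < \<rho>\<close> \<open>0 < C\<close> by simp
    fix \<nu> t assume \<nu>: "\<bar>\<nu>\<bar> < \<rho> / C" and t: "t \<in> {0..T}"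
    have near: "norm (X \<nu> s - e) \<le> C * \<bar>\<nu>\<bar>" if "s \<in> {0..T}" for s
    proof -
      have "norm (X \<nu> s - e) \<le> (norm (X \<nu> 0 - e) + 0) * E"
        unfolding E_def
        by (rule ode_dist_bound[OF lip \<open>0 \<le> K\<close> X, where y = "\<lambda>_. e" and G = "\<lambda>_. F"])
          (use that \<open>F e = 0\<close> in \<open>auto intro!: derivative_eq_intros\<close>)
      also have "\<dots> \<le> C * \<bar>\<nu>\<bar>"
        using \<open>0 < E\<close> by (simp add: X0 C_def algebra_simps)
      finally show ?thesis .
    qed
    have "norm (X \<nu> t - e - \<nu> *\<^sub>R Y t) \<le> (norm (X \<nu> 0 - e - \<nu> *\<^sub>R Y 0) + \<eta> * (C * \<bar>\<nu>\<bar>)) * E'"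
      unfolding E'_def
    proof (rule gronwall_norm[where d = "\<lambda>t. X \<nu> t - e - \<nu> *\<^sub>R Y t"])
      show "((\<lambda>t. X \<nu> t - e - \<nu> *\<^sub>R Y t) has_vector_derivative F (X \<nu> s) - \<nu> *\<^sub>R L (Y s)) (at s)" for s
        by (auto intro!: derivative_eq_intros X Y)
      fix s assume s: "s \<in> {0..T}"
      have "C * \<bar>\<nu>\<bar> < \<rho>" using \<nu> \<open>0 < C\<close> by (simp add: field_simps)
      then have "norm (X \<nu> s - e) < \<rho>" using near[OF s] by simp
      then have 1: "norm (F (X \<nu> s) - F e - L (X \<nu> s - e)) \<le> \<eta> * norm (X \<nu> s - e)" by (rule \<rho>)
      have 2: "\<eta> * norm (X \<nu> s - e) \<le> \<eta> * (C * \<bar>\<nu>\<bar>)"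
        using near[OF s] \<open>0 < \<eta>\<close> by simp
      have 3: "F (X \<nu> s) - \<nu> *\<^sub>R L (Y s)
          = (F (X \<nu> s) - F e - L (X \<nu> s - e)) + L (X \<nu> s - e - \<nu> *\<^sub>R Y s)"
        using linL \<open>F e = 0\<close> by (simp add: linear_diff linear_scale bounded_linear.linear)
      show "norm (F (X \<nu> s) - \<nu> *\<^sub>R L (Y s))
          \<le> B * norm (X \<nu> s - e - \<nu> *\<^sub>R Y s) + \<eta> * (C * \<bar>\<nu>\<bar>)"
        unfolding 3 using norm_triangle_ineq[of "F (X \<nu> s) - F e - L (X \<nu> s - e)" "L (X \<nu> s - e - \<nu> *\<^sub>R Y s)"]
          1 2 B[of "X \<nu> s - e - \<nu> *\<^sub>R Y s"] by (simp add: mult.commute)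
    qed (use \<open>0 < B\<close> \<open>0 < \<eta>\<close> \<open>0 < C\<close> t in auto)
    also have "\<dots> = \<epsilon> * \<bar>\<nu>\<bar>"
      using \<open>0 < C\<close> \<open>0 < E'\<close> by (simp add: X0 \<eta>_def)
    finally show "norm (X \<nu> t - e - \<nu> *\<^sub>R Y t) \<le> \<epsilon> * \<bar>\<nu>\<bar>" .
  qed
qed

text \<open>
  If \<open>S\<close> reverses the field then \<open>t \<mapsto> S (z (c - t))\<close> solves the same equation as \<open>z\<close>, for \<open>c = 0\<close> and, by
  periodicity of the field, for \<open>c = T\<close>. It agrees with \<open>z\<close> at \<open>c / 2\<close>, hence everywhere; the composition of the two
  reflections of time is the translation by \<open>T\<close>.
\<close>

lemma reversible_solution:
  fixes F :: "real \<Rightarrow> 'a::real_inner \<Rightarrow> 'a"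
  assumes lip: "\<And>t x y. norm (F t x - F t y) \<le> K * norm (x - y)" "0 \<le> K"
    and S: "bounded_linear S" and rev: "\<And>t z. F (- t) (S z) = - S (F t z)"
    and per: "\<And>t z. F (t + T) z = F t z"
    and z: "\<And>t. (z has_vector_derivative F t (z t)) (at t)"
    and fixp: "S (z 0) = z 0" "S (z (T / 2)) = z (T / 2)"
  shows "z (T - t) = S (z t)" "z (- t) = S (z t)" "z (t + T) = z t"
proof -
  have mirror: "S (z (c - t)) = z t" if c: "\<And>t z. F (t + c) z = F t z" "S (z (c / 2)) = z (c / 2)" for c t
  proof -
    have "((\<lambda>t. S (z (c - t))) has_vector_derivative F t (S (z (c - t)))) (at t)" for t
    proof -
    have "((\<lambda>t. z (c - t)) has_vector_derivative - F (c - t) (z (c - t))) (at t)"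
      using has_vector_derivative_affine_arg[of z "F (c - t) (z (c - t))" c "-1" t] z[of "c - t"] by simp
    then have "((\<lambda>t. S (z (c - t))) has_vector_derivative S (- F (c - t) (z (c - t)))) (at t)"
      by (rule bounded_linear.has_vector_derivative[OF S])
    moreover have "S (- F (c - t) (z (c - t))) = F t (S (z (c - t)))"
    proof -
      have "F t (S (z (c - t))) = F (- (- t)) (S (z (c - t)))" by simp
      also have "\<dots> = - S (F (- t) (z (c - t)))" by (rule rev)
      also have "F (- t) (z (c - t)) = F (c - t) (z (c - t))" using c(1)[of "- t"] by simp
      finally show ?thesis using S by (simp add: linear_neg bounded_linear.linear)
    qed
    ultimately show ?thesis by simp
    qed
    from ode_unique[OF lip this z, of "c / 2" t] show ?thesis using c(2) by simp
  qed
  have 0: "S (z (- t)) = z t" for t using mirror[of 0 t] fixp by simp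
  have T: "S (z (T - t)) = z t" for t using mirror[of T t] per fixp by simp
  show "z (T - t) = S (z t)" using T[of "T - t"] by simp
  show "z (- t) = S (z t)" using 0[of "- t"] by simp
  show "z (t + T) = z t" using T[of "t + T"] 0[of t] by simp
qed

section \<open>A continuum of zeros in a rectangle\<close>

text \<open>
  A fixed point of the map \<open>p \<mapsto> p - (h p, k p)\<close>, followed by the retraction onto the rectangle, cannot be created by the
  retraction: on each side the corresponding function has the sign that pushes the point into the rectangle.
\<close>

lemma poincare_miranda_rectangle:
  fixes h k :: "real \<times> real \<Rightarrow> real"
  assumes "a \<le> b" "c \<le> d"
    and h: "continuous_on ({a..b} \<times> {c..d}) h" and k: "continuous_on ({a..b} \<times> {c..d}) k"
    and ha: "\<And>y. y \<in> {c..d} \<Longrightarrow> h (a, y) < 0" and hb: "\<And>y. y \<in> {c..d} \<Longrightarrow> 0 < h (b, y)"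
    and kc: "\<And>x. x \<in> {a..b} \<Longrightarrow> k (x, c) < 0" and kd: "\<And>x. x \<in> {a..b} \<Longrightarrow> 0 < k (x, d)"
  obtains p where "p \<in> {a..b} \<times> {c..d}" "h p = 0" "k p = 0"
proof -
  define f where "f p = (max a (min b (fst p - h p)), max c (min d (snd p - k p)))" for p
  obtain p where p: "p \<in> {a..b} \<times> {c..d}" "f p = p"
  proof (rule brouwer)
    show "compact ({a..b} \<times> {c..d})" "convex ({a..b} \<times> {c..d})" "{a..b} \<times> {c..d} \<noteq> {}"
      using assms by (auto simp: compact_Times convex_Times)
    show "continuous_on ({a..b} \<times> {c..d}) f"
      unfolding f_def by (intro continuous_intros h k)
    show "f \<in> {a..b} \<times> {c..d} \<rightarrow> {a..b} \<times> {c..d}"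
      using assms by (auto simp: f_def)
  qed
  obtain x y where xy: "p = (x, y)" by (cases p)
  have fx: "x = max a (min b (x - h p))" and fy: "y = max c (min d (y - k p))"
    using p by (auto simp: f_def xy)
  have "h p = 0"
  proof (rule ccontr)
    assume "h p \<noteq> 0"
    then consider "0 < h p" "x = a" | "h p < 0" "x = b"
      using fx p \<open>a \<le> b\<close> unfolding xy by (auto simp: max_def min_def split: if_splits)
    then show False using ha hb p unfolding xy by cases (auto simp: less_le_not_le)
  qed
  moreover have "k p = 0"
  proof (rule ccontr)
    assume "k p \<noteq> 0"
    then consider "0 < k p" "y = c" | "k p < 0" "y = d"
      using fy p \<open>c \<le> d\<close> unfolding xy by (auto simp: max_def min_def split: if_splits)
    then show False using kc kd p unfolding xy by cases (auto simp: less_le_not_le)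
  qed
  ultimately show ?thesis using that p by blast
qed

text \<open>
  Otherwise no component of the zero set meets both the side \<open>y = c\<close> and the side \<open>y = d\<close>. In a compact set
  components are intersections of clopen sets, so the zero set splits into two disjoint compact parts, one for each of these
  sides. A Urysohn function \<open>k\<close> that is \<open>-1\<close> on the first part and its side and \<open>1\<close> on the second part
  and its side never vanishes on the zero set of \<open>h\<close>, against the theorem of Poincare and Miranda.
\<close>

lemma zero_continuum:
  fixes h :: "real \<times> real \<Rightarrow> real"
  assumes "a \<le> b" "c < d" and h: "continuous_on ({a..b} \<times> {c..d}) h"
    and ha: "\<And>y. y \<in> {c..d} \<Longrightarrow> h (a, y) < 0" and hb: "\<And>y. y \<in> {c..d} \<Longrightarrow> 0 < h (b, y)"
  shows "\<exists>V. compact V \<and> connected V \<and> V \<subseteq> {a..b} \<times> {c..d} \<and> (\<forall>p\<in>V. h p = 0) \<and>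
    (\<forall>y\<in>{c..d}. \<exists>x. (x, y) \<in> V)"
proof -
  define Q where "Q = {a..b} \<times> {c..d}"
  define Z where "Z = Q \<inter> h -` {0}"
  have "compact Q" by (simp add: Q_def compact_Times)
  then have "compact Z"
    unfolding Z_def using h
    by (intro closedin_compact[OF \<open>compact Q\<close>] continuous_closedin_preimage) (auto simp: Q_def)
  define Zc where "Zc = Z \<inter> {p. snd p = c}"
  define Zd where "Zd = Z \<inter> {p. snd p = d}"
  have cl: "closed {p :: real \<times> real. snd p = y}" for y
    by (intro closed_Collect_eq continuous_intros)
  have "compact Zc" "compact Zd"
    unfolding Zc_def Zd_def using \<open>compact Z\<close> cl by (auto intro: compact_Int_closed)
  have "\<exists>C\<in>components Z. C \<inter> Zc \<noteq> {} \<and> C \<inter> Zd \<noteq> {}"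
  proof (rule ccontr)
    assume no: "\<not> ?thesis"
    have "\<exists>K. openin (top_of_set Z) K \<and> compact K \<and> p \<in> K \<and> K \<inter> Zd = {}" if "p \<in> Zc" for p
    proof -
      have "p \<in> Z" using that by (simp add: Zc_def)
      then obtain C where C: "C \<in> components Z" "p \<in> C"
        using Union_components[of Z] by blast
      then have "C \<inter> Zc \<noteq> {}" using that by blast
      then have "C \<inter> Zd = {}" using no C(1) by blast
      then have "C \<subseteq> - Zd" by auto
      have "locally compact Z" "compact C" "open (- Zd)"
        using \<open>compact Z\<close> \<open>compact Zd\<close> C(1)
        by (simp_all add: closed_imp_locally_compact compact_imp_closed open_Compl compact_components)
      then obtain K where "openin (top_of_set Z) K" "compact K" "C \<subseteq> K" "K \<subseteq> - Zd"
        using Sura_Bura_clopen_subset[of Z C "- Zd"] C(1) \<open>C \<subseteq> - Zd\<close> by auto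
      then show ?thesis using C by blast
    qed
    then obtain K where K: "\<And>p. p \<in> Zc \<Longrightarrow> openin (top_of_set Z) (K p) \<and> compact (K p)
        \<and> p \<in> K p \<and> K p \<inter> Zd = {}" by metis
    then have "\<forall>p\<in>Zc. \<exists>W. open W \<and> K p = Z \<inter> W" by (simp add: openin_open)
    from bchoice[OF this] obtain W where W: "\<And>p. p \<in> Zc \<Longrightarrow> open (W p) \<and> K p = Z \<inter> W p"
      by blast
    obtain D where D: "D \<subseteq> Zc" "finite D" "Zc \<subseteq> (\<Union>p\<in>D. W p)"
    proof (rule compactE_image[OF \<open>compact Zc\<close>, of Zc W])
      show "Zc \<subseteq> (\<Union>p\<in>Zc. W p)" using K W by fast
    qed (use W in auto)
    define A where "A = (\<Union>p\<in>D. K p)"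
    define B where "B = Z - (\<Union>p\<in>D. W p)"
    have KD: "compact (K p)" "K p = Z \<inter> W p" "K p \<inter> Zd = {}" if "p \<in> D" for p
      using K W D(1) that by blast+
    have "Zc \<subseteq> Z" by (simp add: Zc_def)
    have A_eq: "A = Z \<inter> (\<Union>p\<in>D. W p)" using KD(2) by (auto simp only: A_def)
    have "compact A" unfolding A_def using D(2) KD(1) by (rule compact_UN)
    moreover have "A \<inter> Zd = {}" using KD(3) unfolding A_def by blast
    moreover have "Zc \<subseteq> A" "A \<subseteq> Z" using A_eq D(3) \<open>Zc \<subseteq> Z\<close> by auto
    ultimately have A: "compact A" "Zc \<subseteq> A" "A \<subseteq> Z" "A \<inter> Zd = {}" by auto
    have B: "compact B" "Zd \<subseteq> B" "A \<union> B = Z" "A \<inter> B = {}"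
    proof -
      show "compact B" unfolding B_def
        using D(1) W \<open>compact Z\<close> by (intro compact_diff open_UN) auto
      show "Zd \<subseteq> B" "A \<union> B = Z" "A \<inter> B = {}"
        using A A_eq by (auto simp: B_def Zd_def)
    qed
    define S where "S = A \<union> {a..b} \<times> {c}"
    \<comment> \<open>the sides belong to these sets so that the sign of the Urysohn function is prescribed there\<close>
  define T where "T = B \<union> {a..b} \<times> {d}"
    have "A \<inter> {a..b} \<times> {d} = {}" using A by (auto simp: Zd_def)
    moreover have "{a..b} \<times> {c} \<inter> B = {}" using A B by (auto simp: Zc_def)
    ultimately have "S \<inter> T = {}" using \<open>c < d\<close> B by (auto simp: S_def T_def)
    moreover have "closed S" "closed T"
      using A B by (auto simp: S_def T_def compact_imp_closed closed_Times intro!: closed_Un)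
    ultimately obtain k :: "real \<times> real \<Rightarrow> real" where k: "continuous_on UNIV k"
      "\<And>x. x \<in> S \<Longrightarrow> k x = -1" "\<And>x. x \<in> T \<Longrightarrow> k x = 1"
      using Urysohn[of S T "-1" 1] by metis
    obtain p where p: "p \<in> {a..b} \<times> {c..d}" "h p = 0" "k p = 0"
    proof (rule poincare_miranda_rectangle[OF \<open>a \<le> b\<close> _ h])
      show "continuous_on ({a..b} \<times> {c..d}) k" using k(1) by (rule continuous_on_subset) simp
    qed (use k \<open>c < d\<close> ha hb in \<open>auto simp: S_def T_def\<close>)
    then have "p \<in> A \<union> B" using B by (auto simp: Z_def Q_def)
    then show False using k(2,3)[of p] p by (auto simp: S_def T_def)
  qed
  then obtain C where C: "C \<in> components Z" "C \<inter> Zc \<noteq> {}" "C \<inter> Zd \<noteq> {}" by blast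
  then have "C \<subseteq> Z" using in_components_subset by blast
  show ?thesis
  proof (intro exI[of _ C] conjI ballI)
    show "compact C" using C \<open>compact Z\<close> compact_components by blast
    show "connected C" using C in_components_connected by blast
    show "C \<subseteq> {a..b} \<times> {c..d}" "\<And>p. p \<in> C \<Longrightarrow> h p = 0"
      using \<open>C \<subseteq> Z\<close> by (auto simp: Z_def Q_def)
    fix y assume y: "y \<in> {c..d}"
    have "connected (snd ` C)"
      using \<open>connected C\<close> by (intro connected_continuous_image continuous_intros)
    moreover have "c \<in> snd ` C" "d \<in> snd ` C" using C by (force simp: Zc_def Zd_def)+
    ultimately have "y \<in> snd ` C"
      using y connectedD_interval[of "snd ` C" c d y] by auto
    then show "\<exists>x. (x, y) \<in> C" by force
  qed
qed

lemma sign_persists: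
  fixes h :: "real \<Rightarrow> real"
  assumes "continuous_on A h" "x \<in> A" "h x \<noteq> 0"
  shows "\<exists>d>0. \<forall>y\<in>A. \<bar>y - x\<bar> < d \<longrightarrow> 0 < h x * h y"
proof -
  have pos: "0 < \<bar>h x\<bar>" using assms(3) by simp
  obtain d where "0 < d" and d: "\<And>y. y \<in> A \<Longrightarrow> dist y x < d \<Longrightarrow> dist (h y) (h x) < \<bar>h x\<bar>"
    using assms(1)[unfolded continuous_on_iff, rule_format, OF assms(2) pos] by blast
  have "0 < h x * h y" if "y \<in> A" "\<bar>y - x\<bar> < d" for y
    using d[of y] that by (cases "0 < h x") (auto simp: zero_less_mult_iff dist_real_def abs_if split: if_splits)
  then show ?thesis using \<open>0 < d\<close> by blast
qed

section \<open>Polar coordinates and star-shaped curves\<close>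

lemma periodic_plus_int:
  fixes h :: "real \<Rightarrow> 'b"
  assumes "\<And>\<theta>. h (\<theta> + T) = h \<theta>"
  shows "h (\<theta> + T * of_int n) = h \<theta>"
proof (induction n rule: int_induct[of _ 0])
  case (step1 i)
  then show ?case using assms[of "\<theta> + T * of_int i"] by (simp add: algebra_simps)
next
  case (step2 i)
  then show ?case using assms[of "\<theta> + T * of_int (i - 1)"] by (simp add: algebra_simps)
qed simp

lemma periodic_representative:
  fixes h :: "real \<Rightarrow> 'b"
  assumes "0 < T" "\<And>\<theta>. h (\<theta> + T) = h \<theta>"
  obtains \<phi> where "\<phi> \<in> {0..T}" "h \<phi> = h \<theta>"
proof (rule that)
  define n where "n = - \<lfloor>\<theta> / T\<rfloor>"
  show "h (\<theta> + T * of_int n) = h \<theta>" using assms(2) by (rule periodic_plus_int)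
  have "of_int \<lfloor>\<theta> / T\<rfloor> * T \<le> \<theta>" using \<open>0 < T\<close> by (simp add: pos_le_divide_eq[symmetric])
  moreover have "\<theta> \<le> (of_int \<lfloor>\<theta> / T\<rfloor> + 1) * T"
    using \<open>0 < T\<close> by (simp add: pos_divide_le_eq[symmetric])
  ultimately show "\<theta> + T * of_int n \<in> {0..T}" by (simp add: n_def algebra_simps)
qed

text \<open>
  The factor \<open>\<sigma> = \<plusminus>1\<close> measures the angle from the starting point, which may lie on either half of
  the axis.
\<close>

definition dir :: "real \<Rightarrow> real \<Rightarrow> real^2" where
  "dir \<sigma> \<theta> = (\<sigma> * cos \<theta>) *\<^sub>R axis 1 1 + (\<sigma> * sin \<theta>) *\<^sub>R axis 2 1"

definition ortho :: "real \<Rightarrow> real \<Rightarrow> real^2" where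
  "ortho \<sigma> \<theta> = (- \<sigma> * sin \<theta>) *\<^sub>R axis 1 1 + (\<sigma> * cos \<theta>) *\<^sub>R axis 2 1"

lemma dir_nth [simp]: "dir \<sigma> \<theta> $ 1 = \<sigma> * cos \<theta>" "dir \<sigma> \<theta> $ 2 = \<sigma> * sin \<theta>"
  and ortho_nth [simp]: "ortho \<sigma> \<theta> $ 1 = - \<sigma> * sin \<theta>" "ortho \<sigma> \<theta> $ 2 = \<sigma> * cos \<theta>"
  by (auto simp: dir_def ortho_def axis_def)

lemma dir_has_vector_derivative: "(dir \<sigma> has_vector_derivative ortho \<sigma> \<theta>) (at \<theta>)"
  unfolding dir_def[abs_def] ortho_def has_vector_derivative_def
  by (auto intro!: derivative_eq_intros simp: algebra_simps)

lemma ortho_has_vector_derivative: "(ortho \<sigma> has_vector_derivative - dir \<sigma> \<theta>) (at \<theta>)"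
  unfolding dir_def ortho_def[abs_def] has_vector_derivative_def
  by (auto intro!: derivative_eq_intros simp: algebra_simps)

lemma continuous_on_dir [continuous_intros]:
  fixes f :: "'a::t2_space \<Rightarrow> real"
  shows "continuous_on A f \<Longrightarrow> continuous_on A (\<lambda>x. dir \<sigma> (f x))"
  "continuous_on A f \<Longrightarrow> continuous_on A (\<lambda>x. ortho \<sigma> (f x))"
  unfolding dir_def ortho_def by (auto intro!: continuous_intros)

lemma dir_plus_2pi [simp]: "dir \<sigma> (\<theta> + 2 * pi) = dir \<sigma> \<theta>" "ortho \<sigma> (\<theta> + 2 * pi) = ortho \<sigma> \<theta>"
  by (auto simp: dir_def ortho_def)

lemma reflect_x_nth [simp]: "reflect_x p $ 1 = p $ 1" "reflect_x p $ 2 = - p $ 2"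
  by (auto simp: reflect_x_def)

lemma reflect_x_dir: "reflect_x (c *\<^sub>R dir \<sigma> \<theta>) = c *\<^sub>R dir \<sigma> (- \<theta>)"
  by (simp add: vec_eq_iff forall_2)

lemma norm_sq_2: "(norm (p :: real^2))\<^sup>2 = (p $ 1)\<^sup>2 + (p $ 2)\<^sup>2"
  unfolding power2_norm_eq_inner inner_vec_def sum_2 by (simp add: power2_eq_square)

lemma inner_2: "(p :: real^2) \<bullet> r = p $ 1 * r $ 1 + p $ 2 * r $ 2"
  by (simp add: inner_vec_def sum_2)

context
  fixes \<sigma> :: real
  assumes \<sigma>: "\<bar>\<sigma>\<bar> = 1"
begin

lemma sigma_sq: "\<sigma> * \<sigma> = 1"
  using \<sigma> by (metis abs_mult_self_eq mult_1)

lemma norm_dir: "norm (dir \<sigma> \<theta>) = 1" "norm (ortho \<sigma> \<theta>) = 1"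
proof -
  have "(norm (dir \<sigma> \<theta>))\<^sup>2 = (\<sigma> * \<sigma>) * ((cos \<theta>)\<^sup>2 + (sin \<theta>)\<^sup>2)"
    "(norm (ortho \<sigma> \<theta>))\<^sup>2 = (\<sigma> * \<sigma>) * ((cos \<theta>)\<^sup>2 + (sin \<theta>)\<^sup>2)"
    by (simp_all only: norm_sq_2 dir_nth ortho_nth) algebra+
  then have "(norm (dir \<sigma> \<theta>))\<^sup>2 = 1" "(norm (ortho \<sigma> \<theta>))\<^sup>2 = 1" by (simp_all add: sigma_sq)
  then show "norm (dir \<sigma> \<theta>) = 1" "norm (ortho \<sigma> \<theta>) = 1"
    by (auto simp: power2_eq_1_iff)
       (smt (verit) norm_ge_zero)+
qed

lemma dir_expansion: "(p \<bullet> dir \<sigma> \<theta>) *\<^sub>R dir \<sigma> \<theta> + (p \<bullet> ortho \<sigma> \<theta>) *\<^sub>R ortho \<sigma> \<theta> = p"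
proof -
  have "(p \<bullet> dir \<sigma> \<theta>) * dir \<sigma> \<theta> $ 1 + (p \<bullet> ortho \<sigma> \<theta>) * ortho \<sigma> \<theta> $ 1
      = (\<sigma> * \<sigma>) * ((cos \<theta>)\<^sup>2 + (sin \<theta>)\<^sup>2) * p $ 1"
    "(p \<bullet> dir \<sigma> \<theta>) * dir \<sigma> \<theta> $ 2 + (p \<bullet> ortho \<sigma> \<theta>) * ortho \<sigma> \<theta> $ 2
      = (\<sigma> * \<sigma>) * ((cos \<theta>)\<^sup>2 + (sin \<theta>)\<^sup>2) * p $ 2"
    by (simp_all only: inner_2 dir_nth ortho_nth) algebra+
  then show ?thesis by (simp add: sigma_sq vec_eq_iff forall_2)
qed

lemma polar_inj:
  assumes "0 < r" "0 < s" "r *\<^sub>R dir \<sigma> \<theta> = s *\<^sub>R dir \<sigma> \<phi>"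
  shows "r = s" "\<exists>n::int. \<theta> = \<phi> + 2 * pi * n"
proof -
  have "norm (r *\<^sub>R dir \<sigma> \<theta>) = norm (s *\<^sub>R dir \<sigma> \<phi>)" using assms by simp
  then show "r = s" using assms(1,2) by (simp add: norm_dir)
  then have "dir \<sigma> \<theta> = dir \<sigma> \<phi>" using assms by simp
  then have "dir \<sigma> \<theta> $ 1 = dir \<sigma> \<phi> $ 1" "dir \<sigma> \<theta> $ 2 = dir \<sigma> \<phi> $ 2" by simp_all
  then have "sin \<theta> = sin \<phi> \<and> cos \<theta> = cos \<phi>" using \<sigma> by auto
  then show "\<exists>n::int. \<theta> = \<phi> + 2 * pi * n" by (simp add: sin_cos_eq_iff)
qed

lemma polar_form:
  obtains \<theta> where "\<theta> \<in> {0..2*pi}" "p = norm p *\<^sub>R dir \<sigma> \<theta>"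
proof (cases "p = 0")
  case True
  then show ?thesis using that[of 0] by simp
next
  case False
  have "(\<sigma> * p $ 1 / norm p)\<^sup>2 + (\<sigma> * p $ 2 / norm p)\<^sup>2
      = (\<sigma> * \<sigma>) * ((p $ 1)\<^sup>2 + (p $ 2)\<^sup>2) / (norm p)\<^sup>2"
    by (simp add: power2_eq_square add_divide_distrib algebra_simps)
  also have "\<dots> = 1" using False unfolding norm_sq_2[symmetric] sigma_sq by simp
  finally have "(\<sigma> * p $ 1 / norm p)\<^sup>2 + (\<sigma> * p $ 2 / norm p)\<^sup>2 = 1" .
  then obtain t where t: "0 \<le> t" "t < 2 * pi" "\<sigma> * p $ 1 / norm p = cos t" "\<sigma> * p $ 2 / norm p = sin t"
    using sincos_total_2pi by metis
  have "norm p * (\<sigma> * cos t) = (\<sigma> * \<sigma>) * p $ 1" "norm p * (\<sigma> * sin t) = (\<sigma> * \<sigma>) * p $ 2"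
    using False by (simp_all add: t(3,4)[symmetric])
  then have "p = norm p *\<^sub>R dir \<sigma> t" by (simp add: vec_eq_iff forall_2 sigma_sq)
  then show ?thesis using that[of t] t by simp
qed

context
  fixes \<rho> :: "real \<Rightarrow> real"
  assumes \<rho>_cont: "continuous_on UNIV \<rho>" and \<rho>_pos: "\<And>\<theta>. 0 < \<rho> \<theta>"
    and \<rho>_periodic: "\<And>\<theta>. \<rho> (\<theta> + 2 * pi) = \<rho> \<theta>"
begin

lemma polar_curve_at:
  obtains \<phi> where "\<phi> \<in> {0..2*pi}" "\<rho> \<phi> *\<^sub>R dir \<sigma> \<phi> = \<rho> \<theta> *\<^sub>R dir \<sigma> \<theta>"
  by (rule periodic_representative[of "2 * pi" "\<lambda>\<theta>. \<rho> \<theta> *\<^sub>R dir \<sigma> \<theta>" \<theta>])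
    (simp_all add: \<rho>_periodic)

lemma simple_closed_polar_curve: "simple_closed_curve (range (\<lambda>\<theta>. \<rho> \<theta> *\<^sub>R dir \<sigma> \<theta>))"
proof -
  define c where "c x = \<rho> (2 * pi * x) *\<^sub>R dir \<sigma> (2 * pi * x)" for x
  have \<rho>c: "continuous_on A (\<lambda>x. \<rho> (f x))" if "continuous_on A f" for A and f :: "real \<Rightarrow> real"
    using continuous_on_compose2[OF \<rho>_cont that] by simp
  have "path c" unfolding path_def c_def by (intro continuous_intros \<rho>c)
  moreover have "x = y \<or> x = 0 \<and> y = 1 \<or> x = 1 \<and> y = 0"
    if "x \<in> {0..1}" "y \<in> {0..1}" "c x = c y" for x y
  proof -
    obtain n :: int where "2 * pi * x = 2 * pi * y + 2 * pi * n"
      using polar_inj(2)[OF \<rho>_pos \<rho>_pos \<open>c x = c y\<close>[unfolded c_def]] by blast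
    then have "2 * pi * x = 2 * pi * (y + n)" by (simp only: distrib_left)
    then have n: "x = y + n" by simp
    then have "-1 \<le> real_of_int n" "real_of_int n \<le> 1" using that by auto
    then have "n = -1 \<or> n = 0 \<or> n = 1" by linarith
    then show ?thesis using n that by auto
  qed
  ultimately have "simple_path c" unfolding simple_path_def loop_free_def by blast
  moreover have "pathfinish c = pathstart c"
    using \<rho>_periodic[of 0] dir_plus_2pi(1)[of \<sigma> 0] by (simp add: c_def pathfinish_def pathstart_def)
  moreover have "path_image c = range (\<lambda>\<theta>. \<rho> \<theta> *\<^sub>R dir \<sigma> \<theta>)"
  proof
    show "path_image c \<subseteq> range (\<lambda>\<theta>. \<rho> \<theta> *\<^sub>R dir \<sigma> \<theta>)" by (auto simp: path_image_def c_def)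
    show "range (\<lambda>\<theta>. \<rho> \<theta> *\<^sub>R dir \<sigma> \<theta>) \<subseteq> path_image c"
    proof clarify
      fix \<theta>
      obtain \<phi> where \<phi>: "\<phi> \<in> {0..2*pi}" "\<rho> \<phi> *\<^sub>R dir \<sigma> \<phi> = \<rho> \<theta> *\<^sub>R dir \<sigma> \<theta>" by (rule polar_curve_at)
      then have "c (\<phi> / (2 * pi)) = \<rho> \<theta> *\<^sub>R dir \<sigma> \<theta>" "\<phi> / (2 * pi) \<in> {0..1}" by (auto simp: c_def field_simps)
      then show "\<rho> \<theta> *\<^sub>R dir \<sigma> \<theta> \<in> path_image c" unfolding path_image_def by (metis imageI)
    qed
  qed
  ultimately show ?thesis unfolding simple_closed_curve_def by blast
qed

text \<open>
  The closed star-shaped region \<open>X\<close> bounded by the curve and the region \<open>Y\<close> on and outside the curve are closed, cover the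
  plane and meet only in the curve. A connected set that avoids the curve and contains 0 therefore stays in \<open>X\<close>.
\<close>

lemma polar_curve_encloses_0: "encloses (range (\<lambda>\<theta>. \<rho> \<theta> *\<^sub>R dir \<sigma> \<theta>)) 0"
proof -
  define S where "S = range (\<lambda>\<theta>. \<rho> \<theta> *\<^sub>R dir \<sigma> \<theta>)"
  define C where "C = connected_component_set (- S) 0"
  have \<rho>_on: "continuous_on {0..2*pi} \<rho>" using \<rho>_cont by (rule continuous_on_subset) simp
  have "compact {0..2*pi}" "{0..2*pi} \<noteq> {}" by auto
  then obtain \<theta>1 \<theta>2 where "\<forall>\<theta>\<in>{0..2*pi}. \<rho> \<theta> \<le> \<rho> \<theta>1" "\<forall>\<theta>\<in>{0..2*pi}. \<rho> \<theta>2 \<le> \<rho> \<theta>"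
    using continuous_attains_sup continuous_attains_inf \<rho>_on by metis
  then have P: "\<And>\<theta>. \<theta> \<in> {0..2*pi} \<Longrightarrow> \<rho> \<theta> \<le> \<rho> \<theta>1" and m: "\<And>\<theta>. \<theta> \<in> {0..2*pi} \<Longrightarrow> \<rho> \<theta>2 \<le> \<rho> \<theta>" by auto
  \<comment> \<open>chosen such that the dilations by factors up to \<open>M\<close> cover the disc of radius \<open>\<rho> \<theta>1 + 1\<close>\<close>
  define M where "M = (\<rho> \<theta>1 + 1) / \<rho> \<theta>2"
  define D where "D I = (\<lambda>(l, \<theta>). (l * \<rho> \<theta>) *\<^sub>R dir \<sigma> \<theta>) ` (I \<times> {0..2*pi})" for I :: "real set"
  have compD: "compact (D {x..y})" for x y
    unfolding D_def split_def
    by (intro compact_continuous_image continuous_intros compact_Times compact_Icc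
        continuous_on_compose2[OF \<rho>_on]) auto
  define X where "X = D {0..1}"
  define Y where "Y = D {1..M} \<union> {p. \<rho> \<theta>1 + 1 \<le> norm p}"
  have "closed {p :: real^2. \<rho> \<theta>1 + 1 \<le> norm p}" by (intro closed_Collect_le continuous_intros)
  then have closed: "closed X" "closed Y"
    unfolding X_def Y_def using compD by (simp_all add: closed_Un compact_imp_closed)
  have cover: "X \<union> Y = UNIV"
  proof -
    have "p \<in> X \<union> Y" if "norm p < \<rho> \<theta>1 + 1" for p
    proof -
      obtain \<theta> where \<theta>: "\<theta> \<in> {0..2*pi}" "p = norm p *\<^sub>R dir \<sigma> \<theta>" by (rule polar_form)
      define l where "l = norm p / \<rho> \<theta>"
      have "norm p = l * \<rho> \<theta>" using \<rho>_pos[of \<theta>] by (simp add: l_def)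
      then have "p = (l * \<rho> \<theta>) *\<^sub>R dir \<sigma> \<theta>" using \<theta>(2) by simp
      moreover have "0 \<le> l" using \<rho>_pos[of \<theta>] by (simp add: l_def)
      moreover have "0 \<le> \<rho> \<theta>1 + 1" using \<rho>_pos[of \<theta>1] by simp
      then have "l \<le> M" unfolding l_def M_def
        using that m[OF \<theta>(1)] \<rho>_pos by (intro frac_le) (auto intro: less_imp_le)
      ultimately show ?thesis using \<theta>(1) unfolding X_def Y_def D_def by (cases "l \<le> 1") force+
    qed
    then show ?thesis by (force simp: Y_def)
  qed
  have X_le: "norm p \<le> \<rho> \<theta>1" if pX: "p \<in> X" for p
  proof -
    obtain l \<theta> where "l \<in> {0..1}" and *: "\<theta> \<in> {0..2*pi}" "p = (l * \<rho> \<theta>) *\<^sub>R dir \<sigma> \<theta>"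
      using pX unfolding X_def D_def by (auto simp del: atLeastAtMost_iff)
    then have "norm p = l * \<rho> \<theta>" using \<rho>_pos[of \<theta>] by (simp add: norm_dir)
    also have "\<dots> \<le> 1 * \<rho> \<theta>" using \<open>l \<in> {0..1}\<close> \<rho>_pos[of \<theta>] by (intro mult_right_mono) auto
    finally show ?thesis using P[OF *(1)] by simp
  qed
  have XY: "X \<inter> Y \<subseteq> S"
  proof
    fix p assume p: "p \<in> X \<inter> Y"
    then have "p \<in> D {1..M}" using X_le by (force simp: Y_def)
    then obtain l' \<phi> where 2: "1 \<le> l'" "p = (l' * \<rho> \<phi>) *\<^sub>R dir \<sigma> \<phi>" by (auto simp: D_def)
    obtain l \<theta> where 1: "0 \<le> l" "l \<le> 1" "p = (l * \<rho> \<theta>) *\<^sub>R dir \<sigma> \<theta>"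
      using p by (auto simp: X_def D_def)
    have pos2: "0 < l' * \<rho> \<phi>" using 2 \<rho>_pos[of \<phi>] by simp
    have "l * \<rho> \<theta> = norm p" using 1 \<rho>_pos[of \<theta>] by (simp add: norm_dir)
    also have "norm p = l' * \<rho> \<phi>" using 2 \<rho>_pos[of \<phi>] by (simp add: norm_dir)
    finally have pos1: "0 < l * \<rho> \<theta>" using pos2 by simp
    have eq: "(l * \<rho> \<theta>) *\<^sub>R dir \<sigma> \<theta> = (l' * \<rho> \<phi>) *\<^sub>R dir \<sigma> \<phi>" using 1 2 by simp
    obtain n :: int where "\<theta> = \<phi> + 2 * pi * n" using polar_inj(2)[OF pos1 pos2 eq] by blast
    then have "\<rho> \<theta> = \<rho> \<phi>" using periodic_plus_int[of \<rho> "2 * pi", OF \<rho>_periodic] by simp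
    then have "l = l'" using polar_inj(1)[OF pos1 pos2 eq] \<rho>_pos[of \<phi>] by simp
    then have "l = 1" using 1 2 by simp
    then show "p \<in> S" using 1 by (auto simp: S_def)
  qed
  have 0: "0 \<notin> S"
  proof
    assume "0 \<in> S"
    then obtain \<theta> where "0 = \<rho> \<theta> *\<^sub>R dir \<sigma> \<theta>" by (auto simp: S_def)
    then have "norm (\<rho> \<theta> *\<^sub>R dir \<sigma> \<theta>) = 0" by simp
    then show False using \<rho>_pos[of \<theta>] by (simp add: norm_dir)
  qed
  have "C \<subseteq> X"
  proof (rule ccontr)
    assume "\<not> C \<subseteq> X"
    then have "Y \<inter> C \<noteq> {}" using cover by blast
    moreover have "0 \<in> X" unfolding X_def D_def by (rule image_eqI[of _ _ "(0, 0)"]) auto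
    then have "X \<inter> C \<noteq> {}" using 0 by (auto simp: C_def)
    moreover have "C \<subseteq> - S" unfolding C_def by (rule connected_component_subset)
    then have "X \<inter> Y \<inter> C = {}" using XY by blast
    moreover have "connected C" unfolding C_def by (rule connected_connected_component)
    ultimately show False using closed cover unfolding connected_closed by blast
  qed
  then have "bounded C"
    using compD[of 0 1] bounded_subset compact_imp_bounded unfolding X_def by blast
  then show ?thesis using 0 unfolding encloses_def inside_def S_def C_def by simp
qed

lemma polar_curve_symmetric:
  assumes "\<And>\<theta>. \<rho> (- \<theta>) = \<rho> \<theta>"
  shows "reflect_x ` range (\<lambda>\<theta>. \<rho> \<theta> *\<^sub>R dir \<sigma> \<theta>) = range (\<lambda>\<theta>. \<rho> \<theta> *\<^sub>R dir \<sigma> \<theta>)"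
proof -
  have "reflect_x (\<rho> \<theta> *\<^sub>R dir \<sigma> \<theta>) = \<rho> (- \<theta>) *\<^sub>R dir \<sigma> (- \<theta>)" for \<theta>
    by (simp add: reflect_x_dir assms)
  then have "reflect_x ` range (\<lambda>\<theta>. \<rho> \<theta> *\<^sub>R dir \<sigma> \<theta>)
      = (\<lambda>\<theta>. \<rho> \<theta> *\<^sub>R dir \<sigma> \<theta>) ` range uminus"
    unfolding image_image by (simp only:)
  also have "range (uminus :: real \<Rightarrow> real) = UNIV" by (rule surj_uminus)
  finally show ?thesis .
qed

end

end

section \<open>The orbit equation in the polar angle\<close>

text \<open>
  Write \<open>r = dir \<theta> / u\<close>. The angular momentum \<open>L = \<parallel>r\<parallel>\<^sup>2 d\<theta>/dt\<close> satisfies \<open>dL/dt = f\<^sub>t / u\<close> with \<open>f\<^sub>t\<close> the tangential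
  part of the force, and \<open>d\<theta>/dt = L u\<^sup>2\<close>. With \<open>N = 1 / L\<^sup>2\<close> in place of \<open>L\<close> the orbit equation becomes polynomial in \<open>q\<close> and \<open>N\<close>.
\<close>

definition orbit_field ::
  "real \<Rightarrow> (real^2 \<Rightarrow> real^2) \<Rightarrow> real \<Rightarrow> real \<times> real \<times> real \<Rightarrow> real \<times> real \<times> real" where
  "orbit_field \<sigma> f \<theta> = (\<lambda>(u, q, N).
     let G = inverse u ^ 3 *\<^sub>R f (inverse u *\<^sub>R dir \<sigma> \<theta>); Gr = G \<bullet> dir \<sigma> \<theta>; Gt = G \<bullet> ortho \<sigma> \<theta>
     in (q, - u - N * (u * Gr + q * Gt), - 2 * N\<^sup>2 * Gt))"

lemma orbit_field_eq:
  "orbit_field \<sigma> f \<theta> z =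
    (fst (snd z),
     - fst z - snd (snd z) * (fst z * (inverse (fst z) ^ 3 * (f (inverse (fst z) *\<^sub>R dir \<sigma> \<theta>) \<bullet> dir \<sigma> \<theta>))
       + fst (snd z) * (inverse (fst z) ^ 3 * (f (inverse (fst z) *\<^sub>R dir \<sigma> \<theta>) \<bullet> ortho \<sigma> \<theta>))),
     - 2 * (snd (snd z))\<^sup>2 * (inverse (fst z) ^ 3 * (f (inverse (fst z) *\<^sub>R dir \<sigma> \<theta>) \<bullet> ortho \<sigma> \<theta>)))"
  by (cases z) (simp add: orbit_field_def Let_def)

lemma real_diffeomorphism:
  fixes \<tau> :: "real \<Rightarrow> real"
  assumes der: "\<And>x. (\<tau> has_real_derivative \<tau>' x) (at x)" and "0 < m" and m: "\<And>x. m \<le> \<tau>' x"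
  obtains \<Theta> where "\<And>t. \<tau> (\<Theta> t) = t" "\<And>x. \<Theta> (\<tau> x) = x"
    "\<And>t. (\<Theta> has_real_derivative inverse (\<tau>' (\<Theta> t))) (at t)"
proof -
  have growth: "m * (y - x) \<le> \<tau> y - \<tau> x" if "x \<le> y" for x y
  proof -
    have "\<tau> x - m * x \<le> \<tau> y - m * y"
    proof (rule DERIV_nonneg_imp_nondecreasing[OF that])
      fix z
      have "((\<lambda>x. \<tau> x - m * x) has_real_derivative \<tau>' z - m) (at z)"
        by (auto intro!: derivative_eq_intros der)
      then show "\<exists>d. ((\<lambda>x. \<tau> x - m * x) has_real_derivative d) (at z) \<and> 0 \<le> d" using m[of z] by auto
    qed
    then show ?thesis by (simp add: algebra_simps)
  qed
  have expand: "m * \<bar>y - x\<bar> \<le> \<bar>\<tau> y - \<tau> x\<bar>" for x y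
    using growth[of x y] growth[of y x] by (cases "x \<le> y") (auto simp: abs_if algebra_simps)
  have "inj \<tau>"
  proof (rule injI)
    fix x y assume "\<tau> x = \<tau> y"
    then have "m * \<bar>y - x\<bar> \<le> 0" using expand[of y x] by simp
    then show "x = y" using \<open>0 < m\<close> by (simp add: mult_le_0_iff)
  qed
  have "\<exists>x. \<tau> x = t" for t
  proof -
    \<comment> \<open>by the linear growth of \<tau> the value \<open>t\<close> is attained in \<open>[-K, K]\<close>\<close>
    define K where "K = \<bar>t - \<tau> 0\<bar> / m"
    have K: "0 \<le> K" "m * K = \<bar>t - \<tau> 0\<bar>" using \<open>0 < m\<close> by (auto simp: K_def)
    have "\<tau> (- K) \<le> t" using growth[of "- K" 0] K by simp
    moreover have "t \<le> \<tau> K" using growth[of 0 K] K by simp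
    ultimately show ?thesis
      using IVT[of \<tau> "- K" t K] K der by (auto intro: DERIV_isCont)
  qed
  then have "surj \<tau>" by (metis surjI)
  define \<Theta> where "\<Theta> = inv \<tau>"
  have 1: "\<tau> (\<Theta> t) = t" for t unfolding \<Theta>_def using \<open>surj \<tau>\<close> by (rule surj_f_inv_f)
  have 2: "\<Theta> (\<tau> x) = x" for x unfolding \<Theta>_def using \<open>inj \<tau>\<close> by (rule inv_f_f)
  have "isCont \<Theta> t" for t
    unfolding continuous_at_eps_delta
  proof (intro allI impI)
    fix e :: real assume "0 < e"
    have "dist (\<Theta> x) (\<Theta> t) < e" if "dist x t < m * e" for x
    proof -
      have "m * \<bar>\<Theta> x - \<Theta> t\<bar> < m * e" using expand[of "\<Theta> x" "\<Theta> t"] that by (auto simp: 1 dist_real_def)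
      then show ?thesis using \<open>0 < m\<close> by (simp add: dist_real_def)
    qed
    then show "\<exists>d>0. \<forall>x. dist x t < d \<longrightarrow> dist (\<Theta> x) (\<Theta> t) < e"
      using \<open>0 < e\<close> \<open>0 < m\<close> by (intro exI[of _ "m * e"]) auto
  qed
  moreover have "\<tau>' x \<noteq> 0" for x using m[of x] \<open>0 < m\<close> by auto
  ultimately have "(\<Theta> has_real_derivative inverse (\<tau>' (\<Theta> t))) (at t)" for t
    using DERIV_inverse_function[where f = \<tau> and g = \<Theta> and a = "t - 1" and b = "t + 1"] der 1 by simp
  then show ?thesis using that 1 2 by blast
qed

text \<open>
  The factor \<open>\<surd>N / u\<^sup>2\<close> is \<open>dt/d\<theta>\<close>, so the two equations say that the velocity and the acceleration of the moving
  point are the expected ones.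
\<close>

lemma orbit_field_acceleration:
  assumes "\<bar>\<sigma>\<bar> = 1"
    and z: "\<And>\<theta>. ((\<lambda>\<theta>. (u \<theta>, q \<theta>, N \<theta>)) has_vector_derivative orbit_field \<sigma> f \<theta> (u \<theta>, q \<theta>, N \<theta>)) (at \<theta>)"
    and pos: "\<And>\<theta>. 0 < u \<theta>" "\<And>\<theta>. 0 < N \<theta>"
  shows "((\<lambda>\<theta>. inverse (u \<theta>) *\<^sub>R dir \<sigma> \<theta>) has_vector_derivative
      (sqrt (N \<theta>) / (u \<theta>)\<^sup>2) *\<^sub>R inverse (sqrt (N \<theta>)) *\<^sub>R (u \<theta> *\<^sub>R ortho \<sigma> \<theta> - q \<theta> *\<^sub>R dir \<sigma> \<theta>)) (at \<theta>)" (is ?pos)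
    "((\<lambda>\<theta>. inverse (sqrt (N \<theta>)) *\<^sub>R (u \<theta> *\<^sub>R ortho \<sigma> \<theta> - q \<theta> *\<^sub>R dir \<sigma> \<theta>)) has_vector_derivative
      (sqrt (N \<theta>) / (u \<theta>)\<^sup>2) *\<^sub>R f (inverse (u \<theta>) *\<^sub>R dir \<sigma> \<theta>)) (at \<theta>)" (is ?acc)
proof -
  define F where "F = f (inverse (u \<theta>) *\<^sub>R dir \<sigma> \<theta>)"
  define Gr where "Gr = inverse (u \<theta>) ^ 3 * (F \<bullet> dir \<sigma> \<theta>)"
  define Gt where "Gt = inverse (u \<theta>) ^ 3 * (F \<bullet> ortho \<sigma> \<theta>)"
  have field: "orbit_field \<sigma> f \<theta> (u \<theta>, q \<theta>, N \<theta>)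
      = (q \<theta>, - u \<theta> - N \<theta> * (u \<theta> * Gr + q \<theta> * Gt), - 2 * (N \<theta>)\<^sup>2 * Gt)"
    by (simp add: orbit_field_def Let_def Gr_def Gt_def F_def)
  have u': "(u has_real_derivative q \<theta>) (at \<theta>)"
    using bounded_linear.has_vector_derivative[OF bounded_linear_fst z[of \<theta>]]
    by (simp add: field has_real_derivative_iff_has_vector_derivative)
  have snd': "((\<lambda>\<theta>. (q \<theta>, N \<theta>)) has_vector_derivative snd (orbit_field \<sigma> f \<theta> (u \<theta>, q \<theta>, N \<theta>))) (at \<theta>)"
    using bounded_linear.has_vector_derivative[OF bounded_linear_snd z[of \<theta>]] by simp
  have q': "(q has_real_derivative - u \<theta> - N \<theta> * (u \<theta> * Gr + q \<theta> * Gt)) (at \<theta>)"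
    using bounded_linear.has_vector_derivative[OF bounded_linear_fst snd']
    by (simp add: field has_real_derivative_iff_has_vector_derivative)
  have N': "(N has_real_derivative - 2 * (N \<theta>)\<^sup>2 * Gt) (at \<theta>)"
    using bounded_linear.has_vector_derivative[OF bounded_linear_snd snd']
    by (simp add: field has_real_derivative_iff_has_vector_derivative)
  define s where "s = sqrt (N \<theta>)"
  have s: "0 < s" "N \<theta> = s * s" "sqrt (N \<theta>) = s" using pos(2)[of \<theta>] by (auto simp: s_def)
  have is': "((\<lambda>\<theta>. inverse (sqrt (N \<theta>))) has_real_derivative s * Gt) (at \<theta>)"
  proof -
    have "((\<lambda>\<theta>. inverse (sqrt (N \<theta>))) has_real_derivative
        - (inverse s * ((- 2 * (N \<theta>)\<^sup>2 * Gt) * (inverse s / 2)) * inverse s)) (at \<theta>)"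
      using s pos(2)[of \<theta>] by (auto intro!: derivative_eq_intros N' simp: s(3) power2_eq_square)
    also have "- (inverse s * ((- 2 * (N \<theta>)\<^sup>2 * Gt) * (inverse s / 2)) * inverse s) = s * Gt"
      using s(1) by (simp add: s(2) power2_eq_square field_simps)
    finally show ?thesis .
  qed
  have iu': "((\<lambda>\<theta>. inverse (u \<theta>)) has_real_derivative - (q \<theta> / (u \<theta>)\<^sup>2)) (at \<theta>)"
    using pos(1)[of \<theta>] by (auto intro!: derivative_eq_intros u' simp: power2_eq_square field_simps)
  have "((\<lambda>\<theta>. inverse (u \<theta>) *\<^sub>R dir \<sigma> \<theta>) has_vector_derivative
      inverse (u \<theta>) *\<^sub>R ortho \<sigma> \<theta> + (- (q \<theta> / (u \<theta>)\<^sup>2)) *\<^sub>R dir \<sigma> \<theta>) (at \<theta>)"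
    by (rule has_vector_derivative_scaleR[OF iu' dir_has_vector_derivative])
  moreover have "inverse (u \<theta>) *\<^sub>R ortho \<sigma> \<theta> + (- (q \<theta> / (u \<theta>)\<^sup>2)) *\<^sub>R dir \<sigma> \<theta>
      = (s / (u \<theta>)\<^sup>2) *\<^sub>R inverse s *\<^sub>R (u \<theta> *\<^sub>R ortho \<sigma> \<theta> - q \<theta> *\<^sub>R dir \<sigma> \<theta>)"
  proof -
    have "s / (u \<theta>)\<^sup>2 * (inverse s * u \<theta>) = inverse (u \<theta>)"
      "s / (u \<theta>)\<^sup>2 * (inverse s * q \<theta>) = q \<theta> / (u \<theta>)\<^sup>2"
      using s(1) pos(1)[of \<theta>] by (auto simp: field_simps power2_eq_square)
    then show ?thesis by (simp add: scaleR_right_diff_distrib)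
  qed
  ultimately show ?pos by (simp add: s(3))
  have "((\<lambda>\<theta>. inverse (sqrt (N \<theta>)) *\<^sub>R (u \<theta> *\<^sub>R ortho \<sigma> \<theta> - q \<theta> *\<^sub>R dir \<sigma> \<theta>)) has_vector_derivative
      inverse s *\<^sub>R ((u \<theta> *\<^sub>R (- dir \<sigma> \<theta>) + q \<theta> *\<^sub>R ortho \<sigma> \<theta>)
        - (q \<theta> *\<^sub>R ortho \<sigma> \<theta> + (- u \<theta> - N \<theta> * (u \<theta> * Gr + q \<theta> * Gt)) *\<^sub>R dir \<sigma> \<theta>))
      + (s * Gt) *\<^sub>R (u \<theta> *\<^sub>R ortho \<sigma> \<theta> - q \<theta> *\<^sub>R dir \<sigma> \<theta>)) (at \<theta>)"
    unfolding s(3)[symmetric]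
    by (rule has_vector_derivative_scaleR[OF is'[folded s(3)]] has_vector_derivative_diff
        has_vector_derivative_scaleR[OF u'] has_vector_derivative_scaleR[OF q']
        dir_has_vector_derivative ortho_has_vector_derivative)+
  moreover have "inverse s *\<^sub>R ((u \<theta> *\<^sub>R (- dir \<sigma> \<theta>) + q \<theta> *\<^sub>R ortho \<sigma> \<theta>)
        - (q \<theta> *\<^sub>R ortho \<sigma> \<theta> + (- u \<theta> - N \<theta> * (u \<theta> * Gr + q \<theta> * Gt)) *\<^sub>R dir \<sigma> \<theta>))
      + (s * Gt) *\<^sub>R (u \<theta> *\<^sub>R ortho \<sigma> \<theta> - q \<theta> *\<^sub>R dir \<sigma> \<theta>)
      = (s / (u \<theta>)\<^sup>2) *\<^sub>R (u \<theta> ^ 3 * Gr) *\<^sub>R dir \<sigma> \<theta> + (s / (u \<theta>)\<^sup>2) *\<^sub>R (u \<theta> ^ 3 * Gt) *\<^sub>R ortho \<sigma> \<theta>"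
  proof -
    have "inverse s * N \<theta> = s" using s by simp
    then have 1: "inverse s * (N \<theta> * (u \<theta> * Gr + q \<theta> * Gt)) = s * (u \<theta> * Gr + q \<theta> * Gt)"
      by (simp only: mult.assoc[symmetric])
    have 2: "(s / (u \<theta>)\<^sup>2) * (u \<theta> ^ 3 * G) = s * u \<theta> * G" for G
      using pos(1)[of \<theta>] by (simp add: power2_eq_square power3_eq_cube)
    have "inverse s *\<^sub>R ((u \<theta> *\<^sub>R (- dir \<sigma> \<theta>) + q \<theta> *\<^sub>R ortho \<sigma> \<theta>)
        - (q \<theta> *\<^sub>R ortho \<sigma> \<theta> + (- u \<theta> - N \<theta> * (u \<theta> * Gr + q \<theta> * Gt)) *\<^sub>R dir \<sigma> \<theta>))
      = (inverse s * (N \<theta> * (u \<theta> * Gr + q \<theta> * Gt))) *\<^sub>R dir \<sigma> \<theta>"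
      by (simp add: algebra_simps)
    then show ?thesis
      unfolding scaleR_scaleR 2 by (simp only: 1) (simp add: algebra_simps)
  qed
  moreover have "(s / (u \<theta>)\<^sup>2) *\<^sub>R (u \<theta> ^ 3 * Gr) *\<^sub>R dir \<sigma> \<theta> + (s / (u \<theta>)\<^sup>2) *\<^sub>R (u \<theta> ^ 3 * Gt) *\<^sub>R ortho \<sigma> \<theta>
      = (s / (u \<theta>)\<^sup>2) *\<^sub>R F"
  proof -
    have "u \<theta> ^ 3 * inverse (u \<theta>) ^ 3 = 1" using pos(1)[of \<theta>] by (simp add: power_inverse)
    then have "u \<theta> ^ 3 * Gr = F \<bullet> dir \<sigma> \<theta>" "u \<theta> ^ 3 * Gt = F \<bullet> ortho \<sigma> \<theta>"
      unfolding Gr_def Gt_def by (simp_all flip: mult.assoc)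
    then show ?thesis
      using dir_expansion[OF \<open>\<bar>\<sigma>\<bar> = 1\<close>, of F \<theta>] by (metis scaleR_add_right)
  qed
  ultimately show ?acc by (simp add: s(3) F_def)
qed

text \<open>
  The time \<tau> is an antiderivative of \<open>\<surd>N / u\<^sup>2\<close>. It is a diffeomorphism of the line since its derivative is bounded
  below, and \<open>\<tau> (\<theta> + 2 \<pi>) = \<tau> \<theta> + T\<close> since that derivative is periodic; so the inverse \<Theta> turns
  \<open>2 \<pi>\<close>-periodicity in the angle into \<open>T\<close>-periodicity in time.
\<close>

lemma orbit_to_solution:
  assumes \<sigma>: "\<bar>\<sigma>\<bar> = 1"
    and z: "\<And>\<theta>. ((\<lambda>\<theta>. (u \<theta>, q \<theta>, N \<theta>)) has_vector_derivative orbit_field \<sigma> f \<theta> (u \<theta>, q \<theta>, N \<theta>)) (at \<theta>)"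
    and per: "\<And>\<theta>. u (\<theta> + 2 * pi) = u \<theta>" "\<And>\<theta>. N (\<theta> + 2 * pi) = N \<theta>"
    and bounds: "\<And>\<theta>. 0 < u \<theta>" "\<And>\<theta>. u \<theta> \<le> b" "0 < c" "\<And>\<theta>. c \<le> N \<theta>"
    and U: "\<And>\<theta>. inverse (u \<theta>) *\<^sub>R dir \<sigma> \<theta> \<in> U"
  obtains r where
    "global_solution f U (inverse (u 0) *\<^sub>R dir \<sigma> 0)
       (inverse (sqrt (N 0)) *\<^sub>R (u 0 *\<^sub>R ortho \<sigma> 0 - q 0 *\<^sub>R dir \<sigma> 0)) r"
    "periodic r" "range r = range (\<lambda>\<theta>. inverse (u \<theta>) *\<^sub>R dir \<sigma> \<theta>)"
proof -
  have Npos: "0 < N \<theta>" for \<theta> using bounds(3,4) by (rule less_le_trans)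
  define \<tau>' where "\<tau>' \<theta> = sqrt (N \<theta>) / (u \<theta>)\<^sup>2" for \<theta>
  have zc: "continuous_on UNIV (\<lambda>\<theta>. (u \<theta>, q \<theta>, N \<theta>))"
    using z by (meson continuous_at_imp_continuous_on has_vector_derivative_continuous)
  have "continuous_on UNIV u" "continuous_on UNIV N"
    using continuous_on_fst[OF zc] continuous_on_snd[OF continuous_on_snd[OF zc]] by simp_all
  then have "continuous_on UNIV \<tau>'"
    unfolding \<tau>'_def using bounds(1) by (intro continuous_intros) (auto simp: less_imp_neq[symmetric])
  from antiderivative_real[OF this] obtain \<tau> where \<tau>: "\<tau> 0 = 0" "\<And>\<theta>. (\<tau> has_real_derivative \<tau>' \<theta>) (at \<theta>)"
    by (auto simp: has_real_derivative_iff_has_vector_derivative)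
  define m where "m = sqrt c / b\<^sup>2"
  have "0 < b" using bounds(1,2) less_le_trans by blast
  then have "0 < m" using bounds by (simp add: m_def)
  have m: "m \<le> \<tau>' \<theta>" for \<theta>
    unfolding m_def \<tau>'_def using bounds(1)[of \<theta>] bounds(2,4) Npos[of \<theta>]
    by (intro frac_le power_mono) auto
  obtain \<Theta> where \<Theta>: "\<And>t. \<tau> (\<Theta> t) = t" "\<And>x. \<Theta> (\<tau> x) = x"
    "\<And>t. (\<Theta> has_real_derivative inverse (\<tau>' (\<Theta> t))) (at t)"
    using real_diffeomorphism[OF \<tau>(2) \<open>0 < m\<close> m] by metis
  have \<tau>'pos: "0 < \<tau>' \<theta>" for \<theta> using \<open>0 < m\<close> m by (rule less_le_trans)
  define T where "T = \<tau> (2 * pi)"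
  have "\<tau> 0 < \<tau> (2 * pi)"
    by (rule DERIV_pos_imp_increasing) (use \<tau>(2) \<tau>'pos in auto)
  then have "0 < T" using \<tau>(1) by (simp add: T_def)
  have "\<tau> (\<theta> + 2 * pi) - \<tau> \<theta> = \<tau> (0 + 2 * pi) - \<tau> 0" for \<theta>
  proof (rule DERIV_isconst_all[rule_format, where f = "\<lambda>\<theta>. \<tau> (\<theta> + 2 * pi) - \<tau> \<theta>"])
    fix x
    have "((\<lambda>\<theta>. \<tau> (\<theta> + 2 * pi)) has_real_derivative \<tau>' (x + 2 * pi)) (at x)"
      using \<tau>(2)[of "x + 2 * pi"] by (simp add: DERIV_shift)
    from DERIV_diff[OF this \<tau>(2)[of x]]
    show "((\<lambda>\<theta>. \<tau> (\<theta> + 2 * pi) - \<tau> \<theta>) has_real_derivative 0) (at x)" by (simp add: \<tau>'_def per)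
  qed
  then have \<tau>T: "\<tau> (\<theta> + 2 * pi) = \<tau> \<theta> + T" for \<theta>
    using \<tau>(1) by (simp add: T_def algebra_simps)
  have \<Theta>T: "\<Theta> (t + T) = \<Theta> t + 2 * pi" for t
    using \<tau>T[of "\<Theta> t"] \<Theta>(2)[of "\<Theta> t + 2 * pi"] by (simp add: \<Theta>(1))
  define P where "P \<theta> = inverse (u \<theta>) *\<^sub>R dir \<sigma> \<theta>" for \<theta>
  define W where "W \<theta> = inverse (sqrt (N \<theta>)) *\<^sub>R (u \<theta> *\<^sub>R ortho \<sigma> \<theta> - q \<theta> *\<^sub>R dir \<sigma> \<theta>)" for \<theta>
  have PW: "(P has_vector_derivative \<tau>' \<theta> *\<^sub>R W \<theta>) (at \<theta>)"
    "(W has_vector_derivative \<tau>' \<theta> *\<^sub>R f (P \<theta>)) (at \<theta>)" for \<theta>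
    using orbit_field_acceleration[OF \<sigma> z bounds(1) Npos]
    unfolding P_def[abs_def] W_def[abs_def] \<tau>'_def by simp_all
  have chain: "((\<lambda>t. h (\<Theta> t)) has_vector_derivative h') (at t)"
    if "(h has_vector_derivative \<tau>' (\<Theta> t) *\<^sub>R h') (at (\<Theta> t))" for h :: "real \<Rightarrow> real^2" and h' t
    using vector_diff_chain_at[OF \<Theta>(3)[unfolded has_real_derivative_iff_has_vector_derivative] that]
      \<tau>'pos[of "\<Theta> t"] by (simp add: o_def)
  have \<Theta>0: "\<Theta> 0 = 0" using \<Theta>(2)[of 0] \<tau>(1) by simp
  define r where "r t = P (\<Theta> t)" for t
  show ?thesis
  proof (rule that)
    show "global_solution f U (inverse (u 0) *\<^sub>R dir \<sigma> 0)
       (inverse (sqrt (N 0)) *\<^sub>R (u 0 *\<^sub>R ortho \<sigma> 0 - q 0 *\<^sub>R dir \<sigma> 0)) r"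
      unfolding global_solution_def
    proof (intro conjI allI exI[of _ "\<lambda>t. W (\<Theta> t)"])
      show "(r has_vector_derivative W (\<Theta> t)) (at t)" for t
        unfolding r_def by (rule chain[OF PW(1)])
      show "((\<lambda>t. W (\<Theta> t)) has_vector_derivative f (r t)) (at t)" for t
        unfolding r_def by (rule chain[OF PW(2)])
    qed (auto simp: r_def P_def W_def \<Theta>0 U)
    have "r (t + T) = r t" for t by (simp add: r_def P_def \<Theta>T per)
    then show "periodic r" unfolding periodic_def using \<open>0 < T\<close> by blast
    have "range \<Theta> = UNIV" using \<Theta>(2) by (metis surjI)
    then have "range (\<lambda>t. P (\<Theta> t)) = range P" by (metis image_image)
    then show "range r = range (\<lambda>\<theta>. inverse (u \<theta>) *\<^sub>R dir \<sigma> \<theta>)"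
      by (simp add: r_def[abs_def] P_def[abs_def])
  qed
qed

section \<open>Regularity and symmetry of the orbit equation\<close>

text \<open>
  Boundedness and the Lipschitz condition go together because only then are they inherited by products. The
  constant is uniform in \<open>p\<close>, which will be the polar angle.
\<close>

definition bdd_lip :: "'a::metric_space set \<Rightarrow> ('p \<Rightarrow> 'a \<Rightarrow> real) \<Rightarrow> bool" where
  "bdd_lip X h \<longleftrightarrow> (\<exists>L\<ge>0. \<forall>p. \<forall>x\<in>X. \<bar>h p x\<bar> \<le> L \<and> (\<forall>y\<in>X. \<bar>h p x - h p y\<bar> \<le> L * dist x y))"

lemma bdd_lipI:
  assumes "\<And>p x. x \<in> X \<Longrightarrow> \<bar>h p x\<bar> \<le> L" "\<And>p x y. x \<in> X \<Longrightarrow> y \<in> X \<Longrightarrow> \<bar>h p x - h p y\<bar> \<le> M * dist x y"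
  shows "bdd_lip X h"
  unfolding bdd_lip_def
proof (intro exI[of _ "max 0 (max L M)"] conjI allI ballI)
  fix p x assume "x \<in> X"
  then show "\<bar>h p x\<bar> \<le> max 0 (max L M)" using assms(1)[of x p] by auto
  fix y assume "y \<in> X"
  have "M * dist x y \<le> max 0 (max L M) * dist x y" by (intro mult_right_mono) auto
  then show "\<bar>h p x - h p y\<bar> \<le> max 0 (max L M) * dist x y"
    using assms(2)[OF \<open>x \<in> X\<close> \<open>y \<in> X\<close>, of p] by linarith
qed simp

lemma bdd_lip_const: "bdd_lip X (\<lambda>p x. c)"
  by (rule bdd_lipI[of _ _ "\<bar>c\<bar>" 0]) auto

lemma bdd_lip_add:
  assumes "bdd_lip X h" "bdd_lip X k"
  shows "bdd_lip X (\<lambda>p x. h p x + k p x)"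
proof -
  obtain L M where L: "\<And>p x. x \<in> X \<Longrightarrow> \<bar>h p x\<bar> \<le> L" "\<And>p x y. x \<in> X \<Longrightarrow> y \<in> X \<Longrightarrow> \<bar>h p x - h p y\<bar> \<le> L * dist x y"
    and M: "\<And>p x. x \<in> X \<Longrightarrow> \<bar>k p x\<bar> \<le> M" "\<And>p x y. x \<in> X \<Longrightarrow> y \<in> X \<Longrightarrow> \<bar>k p x - k p y\<bar> \<le> M * dist x y"
    using assms unfolding bdd_lip_def by metis
  show ?thesis
  proof (rule bdd_lipI[of _ _ "L + M" "L + M"])
    fix p x assume x: "x \<in> X"
    show "\<bar>h p x + k p x\<bar> \<le> L + M" using L(1)[OF x, of p] M(1)[OF x, of p] by linarith
    fix y assume y: "y \<in> X"
    show "\<bar>h p x + k p x - (h p y + k p y)\<bar> \<le> (L + M) * dist x y"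
      using L(2)[OF x y, of p] M(2)[OF x y, of p] by (simp add: distrib_right)
  qed
qed

lemma bdd_lip_mult:
  assumes "bdd_lip X h" "bdd_lip X k"
  shows "bdd_lip X (\<lambda>p x. h p x * k p x)"
proof -
  obtain L M where L: "0 \<le> L" "\<And>p x. x \<in> X \<Longrightarrow> \<bar>h p x\<bar> \<le> L" "\<And>p x y. x \<in> X \<Longrightarrow> y \<in> X \<Longrightarrow> \<bar>h p x - h p y\<bar> \<le> L * dist x y"
    and M: "0 \<le> M" "\<And>p x. x \<in> X \<Longrightarrow> \<bar>k p x\<bar> \<le> M" "\<And>p x y. x \<in> X \<Longrightarrow> y \<in> X \<Longrightarrow> \<bar>k p x - k p y\<bar> \<le> M * dist x y"
    using assms unfolding bdd_lip_def by metis
  show ?thesis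
  proof (rule bdd_lipI[of _ _ "L * M" "L * M + L * M"])
    fix p x assume x: "x \<in> X"
    show "\<bar>h p x * k p x\<bar> \<le> L * M"
      unfolding abs_mult using L(1) L(2)[OF x, of p] M(2)[OF x, of p] by (intro mult_mono) auto
    fix y assume y: "y \<in> X"
    have "\<bar>h p x * (k p x - k p y)\<bar> \<le> L * (M * dist x y)"
      unfolding abs_mult using L(1) L(2)[OF x, of p] M(3)[OF x y, of p] by (intro mult_mono) auto
    moreover have "\<bar>(h p x - h p y) * k p y\<bar> \<le> (L * dist x y) * M"
      unfolding abs_mult using L(1) M(2)[OF y, of p] L(3)[OF x y, of p] by (intro mult_mono) auto
    moreover have "h p x * k p x - h p y * k p y = h p x * (k p x - k p y) + (h p x - h p y) * k p y"
      by (simp add: algebra_simps)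
    ultimately show "\<bar>h p x * k p x - h p y * k p y\<bar> \<le> (L * M + L * M) * dist x y"
      by (simp add: algebra_simps)
  qed
qed

lemma bdd_lip_compose:
  assumes "bdd_lip Y h" "\<And>x. x \<in> X \<Longrightarrow> \<pi> x \<in> Y" "\<And>x y. dist (\<pi> x) (\<pi> y) \<le> dist x y"
  shows "bdd_lip X (\<lambda>p x. h p (\<pi> x))"
proof -
  obtain L where L: "0 \<le> L" "\<And>p x. x \<in> Y \<Longrightarrow> \<bar>h p x\<bar> \<le> L" "\<And>p x y. x \<in> Y \<Longrightarrow> y \<in> Y \<Longrightarrow> \<bar>h p x - h p y\<bar> \<le> L * dist x y"
    using assms(1) unfolding bdd_lip_def by metis
  show ?thesis
  proof (rule bdd_lipI[of _ _ L L])
    fix p x assume x: "x \<in> X"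
    show "\<bar>h p (\<pi> x)\<bar> \<le> L" using L(2) assms(2) x by blast
    fix y assume y: "y \<in> X"
    have "L * dist (\<pi> x) (\<pi> y) \<le> L * dist x y" using L(1) assms(3) by (intro mult_left_mono) auto
    then show "\<bar>h p (\<pi> x) - h p (\<pi> y)\<bar> \<le> L * dist x y"
      using L(3)[OF assms(2)[OF x] assms(2)[OF y], of p] by linarith
  qed
qed

lemma bdd_lip_id: "bdd_lip {a..b :: real} (\<lambda>p x. x)"
  by (rule bdd_lipI[of _ _ "max \<bar>a\<bar> \<bar>b\<bar>" 1]) (auto simp: dist_real_def)

lemma bdd_lip_inverse:
  assumes "0 < a" shows "bdd_lip {a..b :: real} (\<lambda>p x. inverse x)"
proof (rule bdd_lipI[of _ _ "inverse a" "inverse a * inverse a"])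
  fix x assume x: "x \<in> {a..b}"
  then show "\<bar>inverse x\<bar> \<le> inverse a" using assms by (simp add: field_simps)
  fix y assume y: "y \<in> {a..b}"
  have "\<bar>inverse x - inverse y\<bar> = (inverse x * inverse y) * \<bar>x - y\<bar>"
  proof -
    have "inverse x - inverse y = (inverse x * inverse y) * (y - x)"
      using x y assms by (simp add: field_simps)
    then show ?thesis using x y assms by (simp add: abs_mult abs_minus_commute)
  qed
  also have "\<dots> \<le> (inverse a * inverse a) * \<bar>x - y\<bar>"
    using x y assms by (intro mult_right_mono mult_mono) (auto intro: le_imp_inverse_le)
  finally show "\<bar>inverse x - inverse y\<bar> \<le> inverse a * inverse a * dist x y" by (simp add: dist_real_def)
qed

text \<open>
  Only points on one ray are compared. The segment between them stays in the annulus, so a bound for the derivative of \<open>f\<close>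
  on this compact set gives a Lipschitz constant for all rays at once.
\<close>

lemma radial_bdd_lip:
  fixes f :: "real^2 \<Rightarrow> real^2"
  assumes \<sigma>: "\<bar>\<sigma>\<bar> = 1" and "C1_on f U" and "0 < a"
    and U: "\<And>u \<theta>. u \<in> {a..b} \<Longrightarrow> inverse u *\<^sub>R dir \<sigma> \<theta> \<in> U"
    and e: "\<And>\<theta>. norm (e \<theta>) = 1"
  shows "bdd_lip {a..b} (\<lambda>\<theta> u. f (inverse u *\<^sub>R dir \<sigma> \<theta>) \<bullet> e \<theta>)"
proof -
  obtain f' where f': "\<And>p. p \<in> U \<Longrightarrow> (f has_derivative blinfun_apply (f' p)) (at p)" "continuous_on U f'"
    using \<open>C1_on f U\<close> unfolding C1_on_def by blast
  have contf: "continuous_on U f"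
    using f'(1) by (meson continuous_at_imp_continuous_on has_derivative_continuous)
  define A where "A = (\<lambda>(u, \<theta>). inverse u *\<^sub>R dir \<sigma> \<theta>) ` ({a..b} \<times> {0..2*pi})"
  have "compact A"
    unfolding A_def split_def using \<open>0 < a\<close>
    by (intro compact_continuous_image continuous_intros compact_Times compact_Icc) auto
  have "A \<subseteq> U" unfolding A_def using U by auto
  have mem: "inverse u *\<^sub>R dir \<sigma> \<theta> \<in> A" if u: "u \<in> {a..b}" for u \<theta>
  proof -
    obtain \<phi> where \<phi>: "\<phi> \<in> {0..2*pi}" "inverse u *\<^sub>R dir \<sigma> \<phi> = inverse u *\<^sub>R dir \<sigma> \<theta>"
      by (rule periodic_representative[of "2 * pi" "\<lambda>\<theta>. inverse u *\<^sub>R dir \<sigma> \<theta>" \<theta>]) simp_all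
    then show ?thesis using u \<phi> unfolding A_def by (intro image_eqI[of _ _ "(u, \<phi>)"]) auto
  qed
  obtain B where B: "\<And>p. p \<in> A \<Longrightarrow> norm (f p) \<le> B"
    using compact_imp_bounded[OF compact_continuous_image[OF continuous_on_subset[OF contf \<open>A \<subseteq> U\<close>] \<open>compact A\<close>]]
    by (auto simp: bounded_iff)
  obtain B' where B': "\<And>p. p \<in> A \<Longrightarrow> norm (f' p) \<le> B'"
    using compact_imp_bounded[OF compact_continuous_image[OF continuous_on_subset[OF f'(2) \<open>A \<subseteq> U\<close>] \<open>compact A\<close>]]
    by (auto simp: bounded_iff)
  show ?thesis
  proof (rule bdd_lipI[of _ _ B "B' * (inverse a * inverse a)"])
    fix \<theta> x assume x: "x \<in> {a..b}"
    show "\<bar>f (inverse x *\<^sub>R dir \<sigma> \<theta>) \<bullet> e \<theta>\<bar> \<le> B"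
      using Cauchy_Schwarz_ineq2[of "f (inverse x *\<^sub>R dir \<sigma> \<theta>)" "e \<theta>"] e B[OF mem[OF x, of \<theta>]] by simp
    fix y assume y: "y \<in> {a..b}"
    have "norm (f (inverse x *\<^sub>R dir \<sigma> \<theta>) - f (inverse y *\<^sub>R dir \<sigma> \<theta>)) \<le> (B' * (inverse a * inverse a)) * norm (x - y)"
    proof (rule differentiable_bound[OF convex_real_interval(5)])
      fix u assume u: "u \<in> {a..b}"
      let ?p = "inverse u *\<^sub>R dir \<sigma> \<theta>"
      have pA: "?p \<in> A" using mem[OF u] .
      have "u \<noteq> 0" using u \<open>0 < a\<close> by auto
      have "((\<lambda>u. inverse u *\<^sub>R dir \<sigma> \<theta>) has_derivative (\<lambda>h. - (inverse u * h * inverse u) *\<^sub>R dir \<sigma> \<theta>)) (at u within {a..b})"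
        using \<open>u \<noteq> 0\<close> by (auto intro!: derivative_eq_intros)
      then have "((f \<circ> (\<lambda>u. inverse u *\<^sub>R dir \<sigma> \<theta>)) has_derivative
          (blinfun_apply (f' ?p) \<circ> (\<lambda>h. - (inverse u * h * inverse u) *\<^sub>R dir \<sigma> \<theta>))) (at u within {a..b})"
        by (rule diff_chain_within) (use f'(1) pA \<open>A \<subseteq> U\<close> has_derivative_at_withinI in blast)
      then show "((\<lambda>u. f (inverse u *\<^sub>R dir \<sigma> \<theta>)) has_derivative
          (\<lambda>h. blinfun_apply (f' ?p) (- (inverse u * h * inverse u) *\<^sub>R dir \<sigma> \<theta>))) (at u within {a..b})"
        by (simp add: o_def)
      show "onorm (\<lambda>h. blinfun_apply (f' ?p) (- (inverse u * h * inverse u) *\<^sub>R dir \<sigma> \<theta>)) \<le> B' * (inverse a * inverse a)"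
      proof (rule onorm_le)
        fix h :: real
        have "norm (blinfun_apply (f' ?p) (- (inverse u * h * inverse u) *\<^sub>R dir \<sigma> \<theta>))
            \<le> norm (f' ?p) * norm (- (inverse u * h * inverse u) *\<^sub>R dir \<sigma> \<theta>)" by (rule norm_blinfun)
        also have "\<dots> = norm (f' ?p) * ((inverse u * inverse u) * norm h)"
          using u \<open>0 < a\<close> by (simp add: norm_dir[OF \<sigma>] abs_mult)
        also have "\<dots> \<le> B' * ((inverse a * inverse a) * norm h)"
          using u \<open>0 < a\<close> B'[OF pA] order_trans[OF norm_ge_zero B'[OF pA]]
          by (intro mult_mono) (auto intro!: mult_nonneg_nonneg)
        finally show "norm (blinfun_apply (f' ?p) (- (inverse u * h * inverse u) *\<^sub>R dir \<sigma> \<theta>))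
            \<le> B' * (inverse a * inverse a) * norm h" by (simp add: mult.assoc)
      qed
    qed (use x y in auto)
    then show "\<bar>f (inverse x *\<^sub>R dir \<sigma> \<theta>) \<bullet> e \<theta> - f (inverse y *\<^sub>R dir \<sigma> \<theta>) \<bullet> e \<theta>\<bar>
        \<le> B' * (inverse a * inverse a) * dist x y"
      using Cauchy_Schwarz_ineq2[of "f (inverse x *\<^sub>R dir \<sigma> \<theta>) - f (inverse y *\<^sub>R dir \<sigma> \<theta>)" "e \<theta>"] e
      by (simp add: inner_diff_left dist_norm)
  qed
qed

lemma norm_triple_le: "norm (x :: real, y :: real, w :: real) \<le> \<bar>x\<bar> + (\<bar>y\<bar> + \<bar>w\<bar>)"
  using norm_Pair_le[of x "(y, w)"] norm_Pair_le[of y w] by simp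

lemma component_le_norm:
  fixes z :: "real \<times> real \<times> real"
  shows "\<bar>fst z\<bar> \<le> norm z" "\<bar>fst (snd z)\<bar> \<le> norm z" "\<bar>snd (snd z)\<bar> \<le> norm z"
  using norm_fst_le[of "fst z" "snd z"] norm_snd_le[of "snd z" "fst z"]
    norm_fst_le[of "fst (snd z)" "snd (snd z)"] norm_snd_le[of "snd (snd z)" "fst (snd z)"]
  by auto

lemma orbit_field_lipschitz:
  fixes f :: "real^2 \<Rightarrow> real^2"
  assumes \<sigma>: "\<bar>\<sigma>\<bar> = 1" and "C1_on f U" and "0 < a"
    and U: "\<And>u \<theta>. u \<in> {a..b} \<Longrightarrow> inverse u *\<^sub>R dir \<sigma> \<theta> \<in> U"
  obtains K where "0 \<le> K"
    "\<And>\<theta> z. z \<in> {a..b} \<times> {c..d} \<times> {m..n} \<Longrightarrow> norm (orbit_field \<sigma> f \<theta> z) \<le> K"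
    "\<And>\<theta> z z'. z \<in> {a..b} \<times> {c..d} \<times> {m..n} \<Longrightarrow> z' \<in> {a..b} \<times> {c..d} \<times> {m..n} \<Longrightarrow>
        norm (orbit_field \<sigma> f \<theta> z - orbit_field \<sigma> f \<theta> z') \<le> K * norm (z - z')"
proof -
  define X where "X = {a..b} \<times> {c..d} \<times> {m..n}"
  define Gr where "Gr \<theta> u = inverse u ^ 3 * (f (inverse u *\<^sub>R dir \<sigma> \<theta>) \<bullet> dir \<sigma> \<theta>)" for \<theta> u
  define Gt where "Gt \<theta> u = inverse u ^ 3 * (f (inverse u *\<^sub>R dir \<sigma> \<theta>) \<bullet> ortho \<sigma> \<theta>)" for \<theta> u
  have u: "bdd_lip X (\<lambda>\<theta> z. fst z)"
    by (rule bdd_lip_compose[OF bdd_lip_id]) (auto simp: X_def dist_fst_le)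
  have q: "bdd_lip X (\<lambda>\<theta> z. fst (snd z))"
    by (rule bdd_lip_compose[OF bdd_lip_id]) (auto simp: X_def intro: order_trans[OF dist_fst_le dist_snd_le])
  have N: "bdd_lip X (\<lambda>\<theta> z. snd (snd z))"
    by (rule bdd_lip_compose[OF bdd_lip_id]) (auto simp: X_def intro: order_trans[OF dist_snd_le dist_snd_le])
  have G: "bdd_lip {a..b} Gr" "bdd_lip {a..b} Gt"
    unfolding Gr_def[abs_def] Gt_def[abs_def] power3_eq_cube
    by (intro bdd_lip_mult bdd_lip_inverse radial_bdd_lip[OF \<sigma> \<open>C1_on f U\<close> \<open>0 < a\<close> U] norm_dir \<sigma> \<open>0 < a\<close>; assumption)+
  have GX: "bdd_lip X (\<lambda>\<theta> z. Gr \<theta> (fst z))" "bdd_lip X (\<lambda>\<theta> z. Gt \<theta> (fst z))"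
    by (rule bdd_lip_compose[OF G(1)] bdd_lip_compose[OF G(2)]; auto simp: X_def dist_fst_le)+
  \<comment> \<open>the field rewritten as sums and products only, to match the closure rules of \<open>bdd_lip\<close>\<close>
  define h where "h \<theta> z = - 1 * fst z + (- 1 * snd (snd z)) * (fst z * Gr \<theta> (fst z) + fst (snd z) * Gt \<theta> (fst z))"
    for \<theta> and z :: "real \<times> real \<times> real"
  define k where "k \<theta> z = - 2 * (snd (snd z) * snd (snd z)) * Gt \<theta> (fst z)"
    for \<theta> and z :: "real \<times> real \<times> real"
  have eq: "orbit_field \<sigma> f \<theta> z = (fst (snd z), h \<theta> z, k \<theta> z)" for \<theta> z
    by (cases z) (simp add: orbit_field_def Let_def h_def k_def Gr_def Gt_def power2_eq_square)
  have h: "bdd_lip X h"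
    unfolding h_def[abs_def] by (intro bdd_lip_add bdd_lip_mult bdd_lip_const u q N GX)
  have k: "bdd_lip X k"
    unfolding k_def[abs_def] by (intro bdd_lip_add bdd_lip_mult bdd_lip_const u q N GX)
  obtain L1 where L1: "0 \<le> L1" "\<And>z. z \<in> X \<Longrightarrow> \<bar>fst (snd z)\<bar> \<le> L1"
    "\<And>z z'. z \<in> X \<Longrightarrow> z' \<in> X \<Longrightarrow> \<bar>fst (snd z) - fst (snd z')\<bar> \<le> L1 * dist z z'"
    using q unfolding bdd_lip_def by metis
  obtain L2 where L2: "0 \<le> L2" "\<And>\<theta> z. z \<in> X \<Longrightarrow> \<bar>h \<theta> z\<bar> \<le> L2"
    "\<And>\<theta> z z'. z \<in> X \<Longrightarrow> z' \<in> X \<Longrightarrow> \<bar>h \<theta> z - h \<theta> z'\<bar> \<le> L2 * dist z z'"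
    using h unfolding bdd_lip_def by metis
  obtain L3 where L3: "0 \<le> L3" "\<And>\<theta> z. z \<in> X \<Longrightarrow> \<bar>k \<theta> z\<bar> \<le> L3"
    "\<And>\<theta> z z'. z \<in> X \<Longrightarrow> z' \<in> X \<Longrightarrow> \<bar>k \<theta> z - k \<theta> z'\<bar> \<le> L3 * dist z z'"
    using k unfolding bdd_lip_def by metis
  show ?thesis
  proof (rule that[of "L1 + L2 + L3"])
    show "0 \<le> L1 + L2 + L3" using L1 L2 L3 by simp
    show "norm (orbit_field \<sigma> f \<theta> z) \<le> L1 + L2 + L3" if "z \<in> {a..b} \<times> {c..d} \<times> {m..n}" for \<theta> z
      using norm_triple_le[of "fst (snd z)" "h \<theta> z" "k \<theta> z"] L1(2)[of z] L2(2)[of z \<theta>] L3(2)[of z \<theta>] that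
      unfolding eq X_def by linarith
    show "norm (orbit_field \<sigma> f \<theta> z - orbit_field \<sigma> f \<theta> z') \<le> (L1 + L2 + L3) * norm (z - z')"
      if "z \<in> {a..b} \<times> {c..d} \<times> {m..n}" "z' \<in> {a..b} \<times> {c..d} \<times> {m..n}" for \<theta> z z'
      using norm_triple_le[of "fst (snd z) - fst (snd z')" "h \<theta> z - h \<theta> z'" "k \<theta> z - k \<theta> z'"]
        L1(3)[of z z'] L2(3)[of z z' \<theta>] L3(3)[of z z' \<theta>] that
      unfolding eq X_def[symmetric] by (simp add: distrib_right dist_norm)
  qed
qed

definition flip :: "real \<times> real \<times> real \<Rightarrow> real \<times> real \<times> real" where
  "flip z = (fst z, - fst (snd z), snd (snd z))"

lemma bounded_linear_flip: "bounded_linear flip"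
  unfolding flip_def[abs_def]
  by (intro bounded_linear_Pair bounded_linear_minus bounded_linear_fst bounded_linear_snd
      bounded_linear_fst_comp bounded_linear_snd_comp)

text \<open>
  The mirror image of an orbit is an orbit run through with the opposite angle: both \<open>q = du/d\<theta>\<close> and the
  tangential force change sign.
\<close>

lemma orbit_field_flip:
  assumes "f (reflect_x (inverse (fst z) *\<^sub>R dir \<sigma> \<theta>)) = reflect_x (f (inverse (fst z) *\<^sub>R dir \<sigma> \<theta>))"
  shows "orbit_field \<sigma> f (- \<theta>) (flip z) = - flip (orbit_field \<sigma> f \<theta> z)"
proof -
  have "reflect_x p \<bullet> dir \<sigma> (- \<theta>) = p \<bullet> dir \<sigma> \<theta>" "reflect_x p \<bullet> ortho \<sigma> (- \<theta>) = - (p \<bullet> ortho \<sigma> \<theta>)" for p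
    by (simp_all add: inner_2)
  moreover have "f (inverse (fst z) *\<^sub>R dir \<sigma> (- \<theta>)) = reflect_x (f (inverse (fst z) *\<^sub>R dir \<sigma> \<theta>))"
    using assms by (simp add: reflect_x_dir)
  ultimately show ?thesis
    by (cases z) (simp add: orbit_field_def flip_def Let_def algebra_simps)
qed

lemma orbit_field_plus_2pi: "orbit_field \<sigma> f (\<theta> + 2 * pi) z = orbit_field \<sigma> f \<theta> z"
  by (cases z) (simp add: orbit_field_def)

section \<open>The unperturbed and the linearised orbit equation\<close>

text \<open>
  For \<open>N = 1 / L\<^sup>2\<close> this is Binet's equation \<open>u'' + u = \<kappa> u\<^bsup>\<alpha>-1\<^esup> / L\<^sup>2\<close>, and angular momentum is conserved.
\<close>

lemma orbit_field_central_force: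
  assumes \<sigma>: "\<bar>\<sigma>\<bar> = 1" and "0 < u"
    and f: "f (inverse u *\<^sub>R dir \<sigma> \<theta>)
      = - (\<kappa> / norm (inverse u *\<^sub>R dir \<sigma> \<theta>) powr (\<alpha> + 2)) *\<^sub>R (inverse u *\<^sub>R dir \<sigma> \<theta>)"
  shows "orbit_field \<sigma> f \<theta> (u, q, N) = (q, \<kappa> * N * u powr (\<alpha> - 1) - u, 0)"
proof -
  have n: "norm (inverse u *\<^sub>R dir \<sigma> \<theta>) = u powr - 1"
    using \<open>0 < u\<close> by (simp add: norm_dir[OF \<sigma>] powr_minus)
  have "\<kappa> / (u powr - 1) powr (\<alpha> + 2) = \<kappa> * u powr (\<alpha> + 2)"
  proof -
    have "(u powr - 1) powr (\<alpha> + 2) = inverse (u powr (\<alpha> + 2))"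
      by (simp only: powr_powr mult_minus1) (rule powr_minus)
    then show ?thesis by (simp only: divide_inverse inverse_inverse_eq)
  qed
  then have f': "f (inverse u *\<^sub>R dir \<sigma> \<theta>) = (- (\<kappa> * u powr (\<alpha> + 2)) * inverse u) *\<^sub>R dir \<sigma> \<theta>"
    unfolding f n by simp
  have "dir \<sigma> \<theta> \<bullet> dir \<sigma> \<theta> = 1" using norm_dir(1)[OF \<sigma>, of \<theta>] by (simp add: norm_eq_1)
  moreover have "dir \<sigma> \<theta> \<bullet> ortho \<sigma> \<theta> = 0" by (simp add: inner_2)
  moreover have "u powr (\<alpha> + 2) = u powr (\<alpha> - 1) * u ^ 3"
    using \<open>0 < u\<close> powr_add[of u "\<alpha> - 1" 3] by (simp add: add.commute)
  ultimately show ?thesis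
    unfolding orbit_field_eq fst_conv snd_conv f' inner_scaleR_left
    using \<open>0 < u\<close> by (simp add: field_simps power3_eq_cube)
qed

text \<open>
  For \<open>0 < \<beta> \<le> 2\<close> the frequency \<open>\<surd>\<beta>\<close> lies in \<open>(0, \<surd>2]\<close>, where 1 is the only integer; hence
  \<open>sin (\<pi> \<surd>\<beta>)\<close> vanishes for \<open>\<beta> = 1\<close> only.
\<close>

lemma forced_oscillator:
  fixes \<beta> c :: real
  assumes "\<beta> \<le> 2" "\<beta> \<noteq> 1" "0 < c"
  shows "\<exists>Y Y'. (\<forall>t. (Y has_real_derivative Y' t) (at t)) \<and>
    (\<forall>t. (Y' has_real_derivative c - \<beta> * Y t) (at t)) \<and> Y 0 = 0 \<and> Y' 0 = 0 \<and> Y' pi \<noteq> 0"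
proof -
  consider "0 < \<beta>" | "\<beta> = 0" | "\<beta> < 0" by linarith
  then show ?thesis
  proof cases
    case 1
    define w where "w = sqrt \<beta>"
    have w: "0 < w" "\<beta> = w * w" using 1 by (auto simp: w_def)
    have "sin (w * pi) \<noteq> 0"
    proof
      assume "sin (w * pi) = 0"
      then obtain i :: int where "w * pi = i * pi" using sin_zero_iff_int2 by blast
      then have i: "w = i" by simp
      then have "0 < i" using w by simp
      have "i < 2"
      proof (rule ccontr)
        assume "\<not> i < 2"
        then have "2 * 2 \<le> w * w" using i by (intro mult_mono) auto
        then show False using w assms by simp
      qed
      then have "i = 1" using \<open>0 < i\<close> by simp
      then show False using i w assms by simp
    qed
    show ?thesis
    proof (rule exI[of _ "\<lambda>t. c / \<beta> * (1 - cos (w * t))"], rule exI[of _ "\<lambda>t. c / w * sin (w * t)"], intro conjI allI)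
      show "((\<lambda>t. c / \<beta> * (1 - cos (w * t))) has_real_derivative c / w * sin (w * t)) (at t)" for t
        using w by (auto intro!: derivative_eq_intros simp: field_simps)
      show "((\<lambda>t. c / w * sin (w * t)) has_real_derivative c - \<beta> * (c / \<beta> * (1 - cos (w * t)))) (at t)" for t
        using w 1 by (auto intro!: derivative_eq_intros simp: field_simps)
      show "c / w * sin (w * pi) \<noteq> 0" using \<open>sin (w * pi) \<noteq> 0\<close> w assms by simp
    qed auto
  next
    case 2
    show ?thesis
      by (rule exI[of _ "\<lambda>t. c * t\<^sup>2 / 2"], rule exI[of _ "\<lambda>t. c * t"])
        (use 2 assms in \<open>auto intro!: derivative_eq_intros\<close>)
  next
    case 3
    define w where "w = sqrt (- \<beta>)"
    have w: "0 < w" "\<beta> = - (w * w)" using 3 by (auto simp: w_def)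
    show ?thesis
    proof (rule exI[of _ "\<lambda>t. c / \<beta> * (1 - cosh (w * t))"], rule exI[of _ "\<lambda>t. c / w * sinh (w * t)"], intro conjI allI)
      show "((\<lambda>t. c / \<beta> * (1 - cosh (w * t))) has_real_derivative c / w * sinh (w * t)) (at t)" for t
        using w by (auto intro!: derivative_eq_intros simp: field_simps)
      show "((\<lambda>t. c / w * sinh (w * t)) has_real_derivative c - \<beta> * (c / \<beta> * (1 - cosh (w * t)))) (at t)" for t
        using w 3 by (auto intro!: derivative_eq_intros simp: field_simps)
      show "c / w * sinh (w * pi) \<noteq> 0" using w assms by simp
    qed auto
  qed
qed

section \<open>Shooting from the axis to the axis\<close>

lemma continuous_on_orbit_field:
  fixes g :: "(real^2) \<times> real \<Rightarrow> real^2"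
  assumes g: "continuous_on (U \<times> J) g" and "0 < a"
    and U: "\<And>u \<theta>. u \<in> {a..b} \<Longrightarrow> inverse u *\<^sub>R dir \<sigma> \<theta> \<in> U"
  shows "continuous_on (J \<times> UNIV \<times> {a..b} \<times> V) (\<lambda>(\<mu>, \<theta>, z). orbit_field \<sigma> (\<lambda>p. g (p, \<mu>)) \<theta> z)"
proof -
  let ?D = "J \<times> UNIV \<times> {a..b} \<times> V"
  have inv: "continuous_on ?D (\<lambda>x. inverse (fst (snd (snd x))))"
    using \<open>0 < a\<close> by (intro continuous_intros) auto
  have "continuous_on ?D (\<lambda>x. (inverse (fst (snd (snd x))) *\<^sub>R dir \<sigma> (fst (snd x)), fst x))"
    by (intro continuous_intros inv)
  then have G: "continuous_on ?D (\<lambda>x. g (inverse (fst (snd (snd x))) *\<^sub>R dir \<sigma> (fst (snd x)), fst x))"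
    by (rule continuous_on_compose2[OF g]) (use U in auto)
  show ?thesis
    unfolding orbit_field_eq split_def by (intro continuous_intros inv G)
qed

text \<open>
  Precomposition with this retraction onto an interval makes a locally Lipschitz field globally Lipschitz. It is odd
  on symmetric intervals, so it does not destroy the reflection symmetry.
\<close>

definition clip :: "real \<Rightarrow> real \<Rightarrow> real \<Rightarrow> real" where
  "clip lo hi x = max lo (min hi x)"

lemma clip_mem: "lo \<le> hi \<Longrightarrow> clip lo hi x \<in> {lo..hi}"
  and clip_ident: "x \<in> {lo..hi} \<Longrightarrow> clip lo hi x = x"
  and clip_lipschitz: "\<bar>clip lo hi x - clip lo hi y\<bar> \<le> \<bar>x - y\<bar>"
  and clip_uminus: "0 \<le> h \<Longrightarrow> clip (- h) h (- x) = - clip (- h) h x"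
  by (auto simp: clip_def max_def min_def)

locale reversible_perturbation =
  fixes g :: "(real^2) \<times> real \<Rightarrow> real^2" and U :: "(real^2) set" and \<sigma> R a \<kappa> \<alpha> \<rho> :: real
  assumes \<sigma>: "\<bar>\<sigma>\<bar> = 1" and R: "0 < R" and a: "0 < a"
    and g_cont: "continuous_on (U \<times> {-a<..<a}) g"
    and \<kappa>: "0 < \<kappa>" and \<alpha>: "0 \<le> \<alpha>" "\<alpha> \<noteq> 1"
    and g_0: "\<And>p. p \<in> U \<Longrightarrow> g (p, 0) = - (\<kappa> / norm p powr (\<alpha> + 2)) *\<^sub>R p"
    and g_C1: "\<And>\<mu>. \<mu> \<in> {-a<..<a} \<Longrightarrow> C1_on (\<lambda>p. g (p, \<mu>)) U"
    and g_sym: "\<And>\<mu> p. \<mu> \<in> {-a<..<a} \<Longrightarrow> p \<in> U \<Longrightarrow> g (reflect_x p, \<mu>) = reflect_x (g (p, \<mu>))"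
    and \<rho>: "0 < \<rho>" "\<rho> < inverse R"
    and annulus: "\<And>u \<theta>. u \<in> {inverse R - \<rho>..inverse R + \<rho>} \<Longrightarrow> inverse u *\<^sub>R dir \<sigma> \<theta> \<in> U"
begin

text \<open>
  The circular orbit is \<open>circ\<close>: the value \<open>N0\<close> solves \<open>\<kappa> N u0\<^bsup>\<alpha>-1\<^esup> = u0\<close>.
\<close>

abbreviation "u0 \<equiv> inverse R"
definition "N0 = u0 powr (2 - \<alpha>) / \<kappa>"
abbreviation "J \<equiv> {-a<..<a}"
abbreviation "cell \<equiv> {u0 - \<rho>..u0 + \<rho>} \<times> {-1..1 :: real} \<times> {N0 / 2..2 * N0}"
abbreviation "circ \<equiv> (u0, 0 :: real, N0)"

definition clip_box :: "real \<times> real \<times> real \<Rightarrow> real \<times> real \<times> real" where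
  "clip_box z = (clip (u0 - \<rho>) (u0 + \<rho>) (fst z), clip (- 1) 1 (fst (snd z)), clip (N0 / 2) (2 * N0) (snd (snd z)))"

definition \<Phi> :: "real \<Rightarrow> real \<Rightarrow> real \<times> real \<times> real \<Rightarrow> real \<times> real \<times> real" where
  "\<Phi> \<mu> \<theta> z = orbit_field \<sigma> (\<lambda>p. g (p, \<mu>)) \<theta> (clip_box z)"

lemma u0: "0 < u0" "0 < u0 - \<rho>" using R \<rho> by auto

lemma N0: "0 < N0" using u0 \<kappa> by (simp add: N0_def)

lemma zero_in_J: "0 \<in> J" using a by simp

lemma clip_box_mem: "clip_box z \<in> cell"
  using clip_mem[of "u0 - \<rho>" "u0 + \<rho>" "fst z"] clip_mem[of "- 1" 1 "fst (snd z)"]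
    clip_mem[of "N0 / 2" "2 * N0" "snd (snd z)"] \<rho> N0 by (simp add: clip_box_def)

lemma clip_box_ident: "z \<in> cell \<Longrightarrow> clip_box z = z"
  by (cases z) (simp add: clip_box_def clip_ident)

lemma clip_box_lipschitz: "norm (clip_box z - clip_box z') \<le> 3 * norm (z - z')"
proof -
  have "norm (clip_box z - clip_box z') \<le> \<bar>fst (z - z')\<bar> + (\<bar>fst (snd (z - z'))\<bar> + \<bar>snd (snd (z - z'))\<bar>)"
    unfolding clip_box_def diff_Pair fst_diff snd_diff
    by (rule order_trans[OF norm_triple_le]) (intro add_mono clip_lipschitz)
  then show ?thesis using component_le_norm[of "z - z'"] by linarith
qed

lemma clip_box_flip: "clip_box (flip z) = flip (clip_box z)"
  by (simp add: clip_box_def flip_def clip_uminus)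

lemma continuous_clip_box: "continuous_on A clip_box"
  unfolding clip_box_def[abs_def] clip_def by (intro continuous_intros)

lemma \<Phi>_lipschitz:
  assumes "\<mu> \<in> J"
  shows "\<exists>K\<ge>0. (\<forall>\<theta> z. norm (\<Phi> \<mu> \<theta> z) \<le> K) \<and> (\<forall>\<theta> z z'. norm (\<Phi> \<mu> \<theta> z - \<Phi> \<mu> \<theta> z') \<le> K * norm (z - z'))"
proof -
  obtain K where K: "0 \<le> K" "\<And>\<theta> z. z \<in> cell \<Longrightarrow> norm (orbit_field \<sigma> (\<lambda>p. g (p, \<mu>)) \<theta> z) \<le> K"
    "\<And>\<theta> z z'. z \<in> cell \<Longrightarrow> z' \<in> cell \<Longrightarrow>
      norm (orbit_field \<sigma> (\<lambda>p. g (p, \<mu>)) \<theta> z - orbit_field \<sigma> (\<lambda>p. g (p, \<mu>)) \<theta> z') \<le> K * norm (z - z')"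
    using orbit_field_lipschitz[OF \<sigma> g_C1[OF assms] u0(2) annulus] by metis
  show ?thesis
  proof (intro exI[of _ "3 * K"] conjI allI)
    show "norm (\<Phi> \<mu> \<theta> z) \<le> 3 * K" for \<theta> z
      using K(1) K(2)[OF clip_box_mem, of \<theta> z] by (simp add: \<Phi>_def)
    fix \<theta> z z'
    have "norm (\<Phi> \<mu> \<theta> z - \<Phi> \<mu> \<theta> z') \<le> K * norm (clip_box z - clip_box z')"
      unfolding \<Phi>_def by (rule K(3)[OF clip_box_mem clip_box_mem])
    also have "\<dots> \<le> K * (3 * norm (z - z'))"
      by (rule mult_left_mono[OF clip_box_lipschitz K(1)])
    finally show "norm (\<Phi> \<mu> \<theta> z - \<Phi> \<mu> \<theta> z') \<le> 3 * K * norm (z - z')" by simp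
  qed (use K in simp)
qed

lemma continuous_orbit_field_box:
  "continuous_on (J \<times> UNIV \<times> cell) (\<lambda>(\<mu>, \<theta>, z). orbit_field \<sigma> (\<lambda>p. g (p, \<mu>)) \<theta> z)"
  by (rule continuous_on_orbit_field[OF g_cont u0(2) annulus])

lemma continuous_\<Phi>:
  assumes "\<mu> \<in> J"
  shows "continuous_on UNIV (\<lambda>(\<theta>, z). \<Phi> \<mu> \<theta> z)"
proof -
  have "continuous_on UNIV (\<lambda>x. (\<mu>, fst x, clip_box (snd x)))"
    by (intro continuous_intros continuous_on_compose2[OF continuous_clip_box[of UNIV]]) auto
  from continuous_on_compose2[OF continuous_orbit_field_box this]
  show ?thesis using assms clip_box_mem by (simp add: \<Phi>_def split_def image_subset_iff)
qed

text \<open>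
  The clipped field sees only the compact cell, on which continuity in the parameter is uniform.
\<close>

lemma \<Phi>_uniform_in_parameter:
  assumes "\<mu>1 \<in> J" "0 < \<epsilon>"
  shows "\<exists>\<delta>>0. \<forall>\<mu>\<in>J. \<bar>\<mu> - \<mu>1\<bar> < \<delta> \<longrightarrow> (\<forall>t\<in>{0..T}. \<forall>z. norm (\<Phi> \<mu>1 t z - \<Phi> \<mu> t z) \<le> \<epsilon>)"
proof -
  define H where "H = (\<lambda>(\<mu>, \<theta>, z). orbit_field \<sigma> (\<lambda>p. g (p, \<mu>)) \<theta> z)"
  have 1: "continuous_on (J \<times> ({0..T} \<times> cell)) H"
    unfolding H_def by (rule continuous_on_subset[OF continuous_orbit_field_box]) auto
  have 2: "compact ({0..T} \<times> cell)" by (intro compact_Times compact_Icc)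
  obtain X where X: "\<mu>1 \<in> X" "open X"
    "\<forall>\<mu>\<in>X \<inter> J. \<forall>k\<in>{0..T} \<times> cell. dist (H (\<mu>, k)) (H (\<mu>1, k)) \<le> \<epsilon>"
    by (rule continuous_on_prod_compactE[OF 1 2 assms])
  then obtain \<delta> where "0 < \<delta>" and \<delta>: "\<And>\<mu>. dist \<mu> \<mu>1 < \<delta> \<Longrightarrow> \<mu> \<in> X"
    unfolding open_dist by blast
  have "norm (\<Phi> \<mu>1 t z - \<Phi> \<mu> t z) \<le> \<epsilon>" if "\<mu> \<in> J" "\<bar>\<mu> - \<mu>1\<bar> < \<delta>" "t \<in> {0..T}" for \<mu> t z
  proof -
    have "\<mu> \<in> X \<inter> J" using \<delta>[of \<mu>] that by (simp add: dist_real_def)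
    moreover have "(t, clip_box z) \<in> {0..T} \<times> cell" using that clip_box_mem by blast
    ultimately have "dist (\<Phi> \<mu> t z) (\<Phi> \<mu>1 t z) \<le> \<epsilon>"
      using X(3) unfolding \<Phi>_def H_def by fastforce
    then show ?thesis by (simp add: dist_norm norm_minus_commute)
  qed
  then show ?thesis using \<open>0 < \<delta>\<close> by blast
qed

definition sol :: "real \<Rightarrow> real \<times> real \<times> real \<Rightarrow> real \<Rightarrow> real \<times> real \<times> real" where
  "sol \<mu> z0 = (SOME z. z 0 = z0 \<and> (\<forall>t. (z has_vector_derivative \<Phi> \<mu> t (z t)) (at t)))"

lemma sol:
  assumes "\<mu> \<in> J"
  shows "sol \<mu> z0 0 = z0" "(sol \<mu> z0 has_vector_derivative \<Phi> \<mu> t (sol \<mu> z0 t)) (at t)"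
proof -
  obtain K where K: "0 \<le> K" "\<And>\<theta> z. norm (\<Phi> \<mu> \<theta> z) \<le> K"
    "\<And>\<theta> z z'. norm (\<Phi> \<mu> \<theta> z - \<Phi> \<mu> \<theta> z') \<le> K * norm (z - z')"
    using \<Phi>_lipschitz[OF assms] by blast
  have "\<exists>z. z 0 = z0 \<and> (\<forall>t. (z has_vector_derivative \<Phi> \<mu> t (z t)) (at t))"
    using global_existence[OF continuous_\<Phi>[OF assms] K(3,2,1), of z0] by metis
  from someI_ex[OF this]
  show "sol \<mu> z0 0 = z0" "(sol \<mu> z0 has_vector_derivative \<Phi> \<mu> t (sol \<mu> z0 t)) (at t)"
    unfolding sol_def by blast+
qed

lemma sol_continuous:
  assumes "\<mu>1 \<in> J" "0 < \<epsilon>"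
  shows "\<exists>\<delta>>0. \<forall>\<mu>\<in>J. \<forall>z. \<bar>\<mu> - \<mu>1\<bar> < \<delta> \<and> norm (z - z1) < \<delta> \<longrightarrow>
    (\<forall>t\<in>{0..pi}. norm (sol \<mu> z t - sol \<mu>1 z1 t) < \<epsilon>)"
proof -
  obtain K where "0 \<le> K" "\<And>\<theta> z z'. norm (\<Phi> \<mu>1 \<theta> z - \<Phi> \<mu>1 \<theta> z') \<le> K * norm (z - z')"
    using \<Phi>_lipschitz[OF assms(1)] by blast
  then show ?thesis
    by (intro ode_continuous_dependence[where F = \<Phi> and K = K and X = sol])
      (use assms sol \<Phi>_uniform_in_parameter in auto)
qed

definition central :: "real \<times> real \<times> real \<Rightarrow> real \<times> real \<times> real" where
  "central z = (fst (snd z), \<kappa> * snd (snd z) * fst z powr (\<alpha> - 1) - fst z, 0)"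

lemma \<Phi>_0: "\<Phi> 0 \<theta> z = central (clip_box z)"
proof -
  obtain u q N where z: "clip_box z = (u, q, N)" by (cases "clip_box z")
  then have "u \<in> {u0 - \<rho>..u0 + \<rho>}" using clip_box_mem[of z] by simp
  moreover then have "0 < u" using u0(2) by simp
  ultimately show ?thesis
    unfolding \<Phi>_def z central_def by (subst orbit_field_central_force[OF \<sigma>]) (use annulus g_0 in auto)
qed

lemma circ_in_box: "circ \<in> cell" using \<rho> N0 by simp

lemma near_circ_in_box:
  assumes "norm (z - circ) < min \<rho> (min 1 (N0 / 2))"
  shows "z \<in> cell"
  using assms component_le_norm[of "z - circ"] by (cases z) (auto simp: abs_le_iff)

lemma \<kappa>_N0: "\<kappa> * N0 * u0 powr (\<alpha> - 1) = u0" "\<kappa> * N0 * u0 powr (\<alpha> - 2) = 1"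
  using \<kappa> u0(1) powr_add[of u0 "2 - \<alpha>" "\<alpha> - 1"] powr_add[of u0 "2 - \<alpha>" "\<alpha> - 2"] by (simp_all add: N0_def)

lemma circ_equilibrium: "\<Phi> 0 \<theta> circ = 0"
  unfolding \<Phi>_0 clip_box_ident[OF circ_in_box] by (simp add: central_def \<kappa>_N0 zero_prod_def)

text \<open>
  The coefficient \<open>2 - \<alpha>\<close> is the square of the ratio of the radial frequency to the angular frequency on the circular
  orbit (if it is positive).
\<close>

lemma \<Phi>_0_derivative:
  "(\<Phi> 0 \<theta> has_derivative
    (\<lambda>z. (fst (snd z), \<kappa> * u0 powr (\<alpha> - 1) * snd (snd z) - (2 - \<alpha>) * fst z, 0))) (at circ)"
proof -
  have "((\<lambda>u. u powr (\<alpha> - 1)) has_derivative (\<lambda>h. (\<alpha> - 1) * u0 powr (\<alpha> - 2) * h)) (at (fst circ))"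
    using has_real_derivative_powr[OF u0(1), of "\<alpha> - 1"] by (simp add: has_field_derivative_def)
  from has_derivative_compose[OF has_derivative_fst[OF has_derivative_ident] this]
  have pw: "((\<lambda>z :: real \<times> real \<times> real. fst z powr (\<alpha> - 1)) has_derivative
      (\<lambda>h. (\<alpha> - 1) * u0 powr (\<alpha> - 2) * fst h)) (at circ)" by simp
  have "(central has_derivative (\<lambda>h. (fst (snd h),
      (\<kappa> * N0) * ((\<alpha> - 1) * u0 powr (\<alpha> - 2) * fst h) + \<kappa> * snd (snd h) * u0 powr (\<alpha> - 1) - fst h, 0))) (at circ)"
    unfolding central_def[abs_def]
    by (rule derivative_eq_intros pw refl | simp)+
  moreover have "(\<kappa> * N0) * ((\<alpha> - 1) * u0 powr (\<alpha> - 2) * x) + \<kappa> * y * u0 powr (\<alpha> - 1) - x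
      = \<kappa> * u0 powr (\<alpha> - 1) * y - (2 - \<alpha>) * x" for x y
  proof -
    have "(\<kappa> * N0) * ((\<alpha> - 1) * u0 powr (\<alpha> - 2) * x) = (\<kappa> * N0 * u0 powr (\<alpha> - 2)) * ((\<alpha> - 1) * x)"
      by (simp only: mult_ac)
    also have "\<dots> = (\<alpha> - 1) * x" by (simp only: \<kappa>_N0 mult_1)
    finally show ?thesis by (simp only:) (simp add: algebra_simps)
  qed
  ultimately have der: "(central has_derivative
      (\<lambda>z. (fst (snd z), \<kappa> * u0 powr (\<alpha> - 1) * snd (snd z) - (2 - \<alpha>) * fst z, 0))) (at circ)"
    by (simp only:)
  have "0 < min \<rho> (min 1 (N0 / 2))" using \<rho> N0 by simp
  then show ?thesis
  proof (rule has_derivative_transform_within[OF der _ UNIV_I])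
    fix z assume "dist z circ < min \<rho> (min 1 (N0 / 2))"
    then have "z \<in> cell" by (intro near_circ_in_box) (simp only: dist_norm)
    then show "central z = \<Phi> 0 \<theta> z" by (simp only: \<Phi>_0 clip_box_ident)
  qed
qed

lemma sol_circ: "sol 0 circ t = circ"
proof -
  obtain K where "0 \<le> K" and K: "\<And>\<theta> z z'. norm (\<Phi> 0 \<theta> z - \<Phi> 0 \<theta> z') \<le> K * norm (z - z')"
    using \<Phi>_lipschitz[OF zero_in_J] by blast
  have "((\<lambda>t. circ) has_vector_derivative \<Phi> 0 t circ) (at t)" for t
    unfolding circ_equilibrium by (rule has_vector_derivative_const)
  from ode_unique[OF K \<open>0 \<le> K\<close> sol(2)[OF zero_in_J] this, of circ 0 t] sol(1)[OF zero_in_J]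
  show ?thesis by simp
qed

definition shoot :: "real \<Rightarrow> real \<Rightarrow> real" where
  "shoot N \<mu> = fst (snd (sol \<mu> (u0, 0, N) pi))"

lemma continuous_shoot: "continuous_on (UNIV \<times> J) (\<lambda>(N, \<mu>). shoot N \<mu>)"
  unfolding continuous_on_iff
proof (intro ballI allI impI)
  fix x :: "real \<times> real" and e :: real assume x: "x \<in> UNIV \<times> J" and "0 < e"
  obtain N1 \<mu>1 where x_eq: "x = (N1, \<mu>1)" by (cases x)
  then have "\<mu>1 \<in> J" using x by simp
  obtain \<delta> where "0 < \<delta>" and \<delta>: "\<And>\<mu> z. \<mu> \<in> J \<Longrightarrow> \<bar>\<mu> - \<mu>1\<bar> < \<delta> \<Longrightarrow> norm (z - (u0, 0, N1)) < \<delta> \<Longrightarrow>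
      norm (sol \<mu> z pi - sol \<mu>1 (u0, 0, N1) pi) < e"
    using sol_continuous[OF \<open>\<mu>1 \<in> J\<close> \<open>0 < e\<close>, of "(u0, 0, N1)"] pi_ge_zero by (metis atLeastAtMost_iff order_refl)
  have "dist (shoot N \<mu>) (shoot N1 \<mu>1) < e" if "\<mu> \<in> J" "dist (N, \<mu>) (N1, \<mu>1) < \<delta>" for N \<mu>
  proof -
    have "\<bar>N - N1\<bar> < \<delta>" "\<bar>\<mu> - \<mu>1\<bar> < \<delta>"
      using that(2) dist_fst_le[of "(N, \<mu>)" "(N1, \<mu>1)"] dist_snd_le[of "(N, \<mu>)" "(N1, \<mu>1)"]
      by (auto simp: dist_real_def)
    moreover have "norm ((u0, 0, N) - (u0, 0, N1)) = \<bar>N - N1\<bar>" by (simp add: norm_Pair)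
    ultimately have "norm (sol \<mu> (u0, 0, N) pi - sol \<mu>1 (u0, 0, N1) pi) < e" using \<delta> that(1) by simp
    then show ?thesis
      using component_le_norm(2)[of "sol \<mu> (u0, 0, N) pi - sol \<mu>1 (u0, 0, N1) pi"]
      by (simp add: shoot_def dist_real_def)
  qed
  then show "\<exists>d>0. \<forall>x'\<in>UNIV \<times> J. dist x' x < d \<longrightarrow>
      dist ((\<lambda>(N, \<mu>). shoot N \<mu>) x') ((\<lambda>(N, \<mu>). shoot N \<mu>) x) < e"
    using \<open>0 < \<delta>\<close> unfolding x_eq by (intro exI[of _ \<delta>]) auto
qed

text \<open>
  The derivative of \<open>shoot N 0\<close> at \<open>N0\<close> is \<open>Y' \<pi>\<close> for the solution of the linearised equation that starts at
  \<open>(0, 0, 1)\<close>.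
\<close>

lemma shoot_changes_sign:
  "\<exists>s. \<exists>\<delta>>0. \<forall>\<nu>. 0 < \<nu> \<and> \<nu> < \<delta> \<longrightarrow> s * shoot (N0 - \<nu>) 0 < 0 \<and> 0 < s * shoot (N0 + \<nu>) 0"
proof -
  define c where "c = \<kappa> * u0 powr (\<alpha> - 1)"
  have "0 < c" unfolding c_def using \<kappa> u0(1) by (intro mult_pos_pos) simp_all
  obtain Y Y' where Y: "\<And>t. (Y has_real_derivative Y' t) (at t)"
    "\<And>t. (Y' has_real_derivative c - (2 - \<alpha>) * Y t) (at t)" "Y 0 = 0" "Y' 0 = 0" "Y' pi \<noteq> 0"
  proof -
    have "2 - \<alpha> \<le> 2" "2 - \<alpha> \<noteq> 1" using \<alpha> by auto
    from forced_oscillator[OF this \<open>0 < c\<close>] show ?thesis using that by blast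
  qed
  obtain K where K: "0 \<le> K" "\<And>\<theta> z z'. norm (\<Phi> 0 \<theta> z - \<Phi> 0 \<theta> z') \<le> K * norm (z - z')"
    using \<Phi>_lipschitz[OF zero_in_J] by blast
  define L :: "real \<times> real \<times> real \<Rightarrow> real \<times> real \<times> real" where
    "L z = (fst (snd z), c * snd (snd z) - (2 - \<alpha>) * fst z, 0)" for z
  \<comment> \<open>an error of half the linear term cannot change its sign\<close>
  define \<epsilon> where "\<epsilon> = \<bar>Y' pi\<bar> / 2"
  have "0 < \<epsilon>" using Y by (simp add: \<epsilon>_def)
  have "\<exists>\<delta>>0. \<forall>\<nu>. \<bar>\<nu>\<bar> < \<delta> \<longrightarrow> (\<forall>t\<in>{0..pi}.
      norm (sol 0 (u0, 0, N0 + \<nu>) t - circ - \<nu> *\<^sub>R (Y t, Y' t, 1)) \<le> \<epsilon> * \<bar>\<nu>\<bar>)"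
  proof (rule ode_linearisation_at_equilibrium[where F = "\<Phi> 0 0" and K = K and L = L])
    show "(\<Phi> 0 0 has_derivative L) (at circ)"
      using \<Phi>_0_derivative unfolding L_def[abs_def] c_def by simp
    show "((\<lambda>t. (Y t, Y' t, 1)) has_vector_derivative L (Y t, Y' t, 1)) (at t)" for t
      using Y(1,2)[of t] unfolding L_def has_real_derivative_iff_has_vector_derivative
      by (auto intro!: has_vector_derivative_Pair has_vector_derivative_const)
    show "sol 0 (u0, 0, N0 + \<nu>) 0 = circ + \<nu> *\<^sub>R (Y 0, Y' 0, 1)" for \<nu>
      using Y sol(1)[OF zero_in_J] by simp
    show "(sol 0 (u0, 0, N0 + \<nu>) has_vector_derivative \<Phi> 0 0 (sol 0 (u0, 0, N0 + \<nu>) t)) (at t)" for \<nu> t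
      using sol(2)[OF zero_in_J] by (simp add: \<Phi>_0)
  qed (use K circ_equilibrium \<open>0 < \<epsilon>\<close> in auto)
  then obtain \<delta> where "0 < \<delta>" and \<delta>: "\<And>\<nu>. \<bar>\<nu>\<bar> < \<delta> \<Longrightarrow>
      norm (sol 0 (u0, 0, N0 + \<nu>) pi - circ - \<nu> *\<^sub>R (Y pi, Y' pi, 1)) \<le> \<epsilon> * \<bar>\<nu>\<bar>"
    by (metis atLeastAtMost_iff order_refl pi_ge_zero)
  have main: "\<bar>shoot (N0 + \<nu>) 0 - \<nu> * Y' pi\<bar> \<le> \<bar>\<nu> * Y' pi\<bar> / 2" if "\<bar>\<nu>\<bar> < \<delta>" for \<nu>
    using \<delta>[OF that] component_le_norm(2)[of "sol 0 (u0, 0, N0 + \<nu>) pi - circ - \<nu> *\<^sub>R (Y pi, Y' pi, 1)"]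
    by (simp add: shoot_def \<epsilon>_def abs_mult mult.commute)
  have sgn: "0 < \<nu> * Y' pi * shoot (N0 + \<nu>) 0" if "\<bar>\<nu>\<bar> < \<delta>" "\<nu> \<noteq> 0" for \<nu>
  proof -
    define y where "y = \<nu> * Y' pi"
    have "y \<noteq> 0" using that Y by (simp add: y_def)
    moreover have "\<bar>shoot (N0 + \<nu>) 0 - y\<bar> \<le> \<bar>y\<bar> / 2" unfolding y_def by (rule main[OF that(1)])
    ultimately have "0 < y * shoot (N0 + \<nu>) 0"
      by (cases "0 < y") (auto simp: zero_less_mult_iff abs_if split: if_splits)
    then show ?thesis by (simp add: y_def)
  qed
  show ?thesis
  proof (rule exI[of _ "Y' pi"], rule exI[of _ \<delta>], intro conjI allI impI)
    show "0 < \<delta>" by fact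
    fix \<nu> assume \<nu>: "0 < \<nu> \<and> \<nu> < \<delta>"
    show "Y' pi * shoot (N0 - \<nu>) 0 < 0"
      using sgn[of "- \<nu>"] \<nu> by (simp add: zero_less_mult_iff mult_less_0_iff)
    show "0 < Y' pi * shoot (N0 + \<nu>) 0"
      using sgn[of "\<nu>"] \<nu> by (simp add: zero_less_mult_iff mult_less_0_iff)
  qed
qed

section \<open>Closed orbits\<close>

lemma \<Phi>_flip:
  assumes "\<mu> \<in> J"
  shows "\<Phi> \<mu> (- t) (flip z) = - flip (\<Phi> \<mu> t z)"
proof -
  have "fst (clip_box z) \<in> {u0 - \<rho>..u0 + \<rho>}" using clip_box_mem[of z] by (simp add: mem_Times_iff)
  then show ?thesis
    unfolding \<Phi>_def clip_box_flip by (intro orbit_field_flip g_sym[OF assms] annulus)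
qed

text \<open>
  The initial velocity of the orbit with parameter \<open>N\<close> is perpendicular to the axis and has length \<open>L / R = u0 / \<surd>N\<close>.
\<close>

definition closed_orbit :: "real \<Rightarrow> real \<Rightarrow> (real \<Rightarrow> real^2) \<Rightarrow> bool" where
  "closed_orbit N \<mu> r \<longleftrightarrow>
    global_solution (\<lambda>p. g (p, \<mu>)) U (R *\<^sub>R dir \<sigma> 0) ((inverse (sqrt N) * u0) *\<^sub>R ortho \<sigma> 0) r \<and>
    periodic r \<and> simple_closed_curve (range r) \<and> reflect_x ` range r = range r \<and> encloses (range r) 0"

text \<open>
  Near the circular orbit the solution stays in the cell for angles in \<open>[0, \<pi>]\<close>, and by symmetry and periodicity for all
  angles. There clipping has no effect, so the solution is a true orbit.
\<close>

lemma closed_orbit_of_zero: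
  "\<exists>\<delta>>0. \<forall>\<mu>\<in>J. \<forall>N. \<bar>\<mu>\<bar> < \<delta> \<longrightarrow> \<bar>N - N0\<bar> < \<delta> \<longrightarrow> shoot N \<mu> = 0 \<longrightarrow> (\<exists>r. closed_orbit N \<mu> r)"
proof -
  have "0 < min \<rho> (min 1 (N0 / 2))" using \<rho> N0 by simp
  from sol_continuous[OF zero_in_J this, of circ]
  obtain \<delta> where "0 < \<delta>" and \<delta>: "\<And>\<mu> z t. \<mu> \<in> J \<Longrightarrow> \<bar>\<mu>\<bar> < \<delta> \<Longrightarrow> norm (z - circ) < \<delta> \<Longrightarrow> t \<in> {0..pi} \<Longrightarrow>
      norm (sol \<mu> z t - circ) < min \<rho> (min 1 (N0 / 2))"
    unfolding sol_circ by auto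
  have "\<exists>r. closed_orbit N \<mu> r" if \<mu>: "\<mu> \<in> J" "\<bar>\<mu>\<bar> < \<delta>" and N: "\<bar>N - N0\<bar> < \<delta>" and "shoot N \<mu> = 0" for N \<mu>
  proof -
    define z where "z = sol \<mu> (u0, 0, N)"
    have z0: "z 0 = (u0, 0, N)" unfolding z_def by (rule sol(1)[OF \<mu>(1)])
    have dz: "(z has_vector_derivative \<Phi> \<mu> t (z t)) (at t)" for t
      unfolding z_def by (rule sol(2)[OF \<mu>(1)])
    have "norm ((u0, 0, N) - circ) = \<bar>N - N0\<bar>" by (simp add: norm_Pair)
    then have half: "z t \<in> cell" if "t \<in> {0..pi}" for t
      unfolding z_def by (intro near_circ_in_box \<delta>) (use \<mu> N that in auto)
    obtain K where K: "0 \<le> K" "\<And>\<theta> z z'. norm (\<Phi> \<mu> \<theta> z - \<Phi> \<mu> \<theta> z') \<le> K * norm (z - z')"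
      using \<Phi>_lipschitz[OF \<mu>(1)] by blast
    have per\<Phi>: "\<Phi> \<mu> (t + 2 * pi) y = \<Phi> \<mu> t y" for t y by (simp add: \<Phi>_def orbit_field_plus_2pi)
    have "fst (snd (z pi)) = 0" using \<open>shoot N \<mu> = 0\<close> by (simp add: shoot_def z_def)
    then have fixed: "flip (z 0) = z 0" "flip (z (2 * pi / 2)) = z (2 * pi / 2)"
      by (simp_all add: z0 flip_def prod_eq_iff)
    note sym = reversible_solution[where F = "\<Phi> \<mu>" and S = flip and z = z and T = "2 * pi" and K = K,
        OF K(2,1) bounded_linear_flip \<Phi>_flip[OF \<mu>(1)] per\<Phi> dz fixed]
    have in_cell: "z \<theta> \<in> cell" for \<theta>
    proof -
      obtain \<phi> where \<phi>: "\<phi> \<in> {0..2*pi}" "z \<phi> = z \<theta>"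
        by (rule periodic_representative[of "2 * pi" z \<theta>]) (use sym(3) in auto)
      show ?thesis
      proof (cases "\<phi> \<le> pi")
        case True
        then show ?thesis using half[of \<phi>] \<phi> by simp
      next
        case False
        then have "flip (z (2 * pi - \<phi>)) = z \<theta>" using sym(1)[of "2 * pi - \<phi>"] \<phi> by simp
        moreover have "z (2 * pi - \<phi>) \<in> cell" using half[of "2 * pi - \<phi>"] False \<phi> by simp
        moreover have "flip y \<in> cell" if "y \<in> cell" for y using that by (cases y) (auto simp: flip_def)
        ultimately show ?thesis by metis
      qed
    qed
    define u where "u \<theta> = fst (z \<theta>)" for \<theta>
    define q where "q \<theta> = fst (snd (z \<theta>))" for \<theta>
    define M where "M \<theta> = snd (snd (z \<theta>))" for \<theta>
    have z_eq: "z = (\<lambda>\<theta>. (u \<theta>, q \<theta>, M \<theta>))" by (simp add: u_def q_def M_def)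
    have bounds: "u \<theta> \<in> {u0 - \<rho>..u0 + \<rho>}" "N0 / 2 \<le> M \<theta>" for \<theta>
      using in_cell[of \<theta>] by (simp_all add: z_eq)
    have u_pos: "0 < u \<theta>" for \<theta> using bounds(1)[of \<theta>] u0(2) by simp
    have field: "((\<lambda>\<theta>. (u \<theta>, q \<theta>, M \<theta>)) has_vector_derivative
        orbit_field \<sigma> (\<lambda>p. g (p, \<mu>)) \<theta> (u \<theta>, q \<theta>, M \<theta>)) (at \<theta>)" for \<theta>
      using dz[of \<theta>] clip_box_ident[OF in_cell[of \<theta>]] unfolding \<Phi>_def by (simp add: z_eq)
    have per: "u (\<theta> + 2 * pi) = u \<theta>" "M (\<theta> + 2 * pi) = M \<theta>" "u (- \<theta>) = u \<theta>" for \<theta>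
      using sym(2,3)[of \<theta>] by (simp_all add: u_def M_def flip_def)
    obtain r where r: "global_solution (\<lambda>p. g (p, \<mu>)) U (inverse (u 0) *\<^sub>R dir \<sigma> 0)
       (inverse (sqrt (M 0)) *\<^sub>R (u 0 *\<^sub>R ortho \<sigma> 0 - q 0 *\<^sub>R dir \<sigma> 0)) r"
      "periodic r" "range r = range (\<lambda>\<theta>. inverse (u \<theta>) *\<^sub>R dir \<sigma> \<theta>)"
    proof (rule orbit_to_solution[OF \<sigma> field per(1,2) u_pos])
      show "u \<theta> \<le> u0 + \<rho>" for \<theta> using bounds(1)[of \<theta>] by simp
      show "0 < N0 / 2" using N0 by simp
      show "inverse (u \<theta>) *\<^sub>R dir \<sigma> \<theta> \<in> U" for \<theta> by (rule annulus[OF bounds(1)])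
    qed (use bounds(2) in auto)
    have cont: "continuous_on UNIV (\<lambda>\<theta>. inverse (u \<theta>))"
    proof -
      have "continuous_on UNIV z"
        using dz by (meson continuous_at_imp_continuous_on has_vector_derivative_continuous)
      then have "continuous_on UNIV u" unfolding u_def by (intro continuous_intros)
      then show ?thesis by (rule continuous_on_inverse) (use u_pos in \<open>auto simp: less_imp_neq[symmetric]\<close>)
    qed
    have pos: "0 < inverse (u \<theta>)" for \<theta> using u_pos by simp
    have "closed_orbit N \<mu> r"
      unfolding closed_orbit_def r(3)
    proof (intro conjI)
      show "global_solution (\<lambda>p. g (p, \<mu>)) U (R *\<^sub>R dir \<sigma> 0) ((inverse (sqrt N) * u0) *\<^sub>R ortho \<sigma> 0) r"
        using r(1) z0 by (simp add: z_eq)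
      show "simple_closed_curve (range (\<lambda>\<theta>. inverse (u \<theta>) *\<^sub>R dir \<sigma> \<theta>))"
        by (rule simple_closed_polar_curve[OF \<sigma> cont pos]) (simp add: per)
      show "encloses (range (\<lambda>\<theta>. inverse (u \<theta>) *\<^sub>R dir \<sigma> \<theta>)) 0"
        by (rule polar_curve_encloses_0[OF \<sigma> cont pos]) (simp add: per)
      show "reflect_x ` range (\<lambda>\<theta>. inverse (u \<theta>) *\<^sub>R dir \<sigma> \<theta>) = range (\<lambda>\<theta>. inverse (u \<theta>) *\<^sub>R dir \<sigma> \<theta>)"
        by (rule polar_curve_symmetric[OF \<sigma> cont pos]) (simp_all add: per)
    qed (rule r(2))
    then show ?thesis by blast
  qed
  then show ?thesis using \<open>0 < \<delta>\<close> by blast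
qed

lemma closed_orbit_continuum:
  "\<exists>\<delta>0. 0 < \<delta>0 \<and> \<delta>0 < a \<and>
    (\<forall>\<mu>\<in>{-\<delta>0<..<\<delta>0}. \<exists>v r. global_solution (\<lambda>p. g (p, \<mu>)) U (R *\<^sub>R dir \<sigma> 0) v r \<and> periodic r) \<and>
    (\<exists>V :: ((real^2) \<times> real) set.
       compact V \<and> connected V \<and> V \<subseteq> UNIV \<times> J \<and>
       (\<forall>\<mu>\<in>{0..\<delta>0}. V \<inter> (UNIV \<times> {\<mu>}) \<noteq> {}) \<and>
       (\<forall>(v, \<mu>)\<in>V. \<exists>r. global_solution (\<lambda>p. g (p, \<mu>)) U (R *\<^sub>R dir \<sigma> 0) v r \<and> periodic r \<and>
          simple_closed_curve (range r) \<and>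
          reflect_x ` range r = range r \<and>
          encloses (range r) 0))"
proof -
  obtain s \<delta>1 where "0 < \<delta>1" and s: "\<And>\<nu>. 0 < \<nu> \<Longrightarrow> \<nu> < \<delta>1 \<Longrightarrow> s * shoot (N0 - \<nu>) 0 < 0"
    "\<And>\<nu>. 0 < \<nu> \<Longrightarrow> \<nu> < \<delta>1 \<Longrightarrow> 0 < s * shoot (N0 + \<nu>) 0"
    using shoot_changes_sign by blast
  obtain \<delta>2 where "0 < \<delta>2" and \<delta>2:
    "\<And>N \<mu>. \<mu> \<in> J \<Longrightarrow> \<bar>\<mu>\<bar> < \<delta>2 \<Longrightarrow> \<bar>N - N0\<bar> < \<delta>2 \<Longrightarrow> shoot N \<mu> = 0 \<Longrightarrow> \<exists>r. closed_orbit N \<mu> r"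
    using closed_orbit_of_zero by blast
  \<comment> \<open>the bound by \<open>N0\<close> keeps \<open>N\<close> positive, so that the initial velocity depends continuously on it\<close>
  define \<eta> where "\<eta> = min \<delta>1 (min \<delta>2 N0) / 2"
  have \<eta>: "0 < \<eta>" "\<eta> < \<delta>1" "\<eta> < \<delta>2" "\<eta> < N0"
    using \<open>0 < \<delta>1\<close> \<open>0 < \<delta>2\<close> N0 by (auto simp: \<eta>_def min_def)
  define H where "H = (\<lambda>(N, \<mu>). s * shoot N \<mu>)"
  have H_cont: "continuous_on (UNIV \<times> J) H"
    unfolding H_def split_def
    using continuous_on_mult_left[OF continuous_shoot, of s] by (simp add: split_def)
  have H_slice: "continuous_on J (\<lambda>\<mu>. H (N, \<mu>))" for N
    by (rule continuous_on_compose2[OF H_cont]) (auto intro!: continuous_intros)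
  have H0: "H (N0 - \<eta>, 0) < 0" "0 < H (N0 + \<eta>, 0)" using s \<eta> by (auto simp: H_def)
  obtain d1 where d1: "0 < d1" "\<And>\<mu>. \<mu> \<in> J \<Longrightarrow> \<bar>\<mu>\<bar> < d1 \<Longrightarrow> 0 < H (N0 - \<eta>, 0) * H (N0 - \<eta>, \<mu>)"
    using sign_persists[OF H_slice zero_in_J less_imp_neq[OF H0(1)]] unfolding diff_zero by blast
  obtain d2 where d2: "0 < d2" "\<And>\<mu>. \<mu> \<in> J \<Longrightarrow> \<bar>\<mu>\<bar> < d2 \<Longrightarrow> 0 < H (N0 + \<eta>, 0) * H (N0 + \<eta>, \<mu>)"
    using sign_persists[OF H_slice zero_in_J less_imp_neq[OF H0(2), symmetric]] unfolding diff_zero by blast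
  define \<delta>0 where "\<delta>0 = min (min d1 d2) (min \<delta>2 a) / 2"
  have \<delta>0: "0 < \<delta>0" "\<delta>0 < d1" "\<delta>0 < d2" "\<delta>0 < \<delta>2" "\<delta>0 < a"
    using d1(1) d2(1) \<open>0 < \<delta>2\<close> a by (auto simp: \<delta>0_def min_def)
  have in_J: "\<mu> \<in> J" if "\<bar>\<mu>\<bar> \<le> \<delta>0" for \<mu> using that \<delta>0(5) by auto
  have left: "H (N0 - \<eta>, \<mu>) < 0" and right: "0 < H (N0 + \<eta>, \<mu>)" if "\<bar>\<mu>\<bar> \<le> \<delta>0" for \<mu>
    using d1(2)[OF in_J[OF that]] d2(2)[OF in_J[OF that]] that \<delta>0 H0
    by (auto simp: zero_less_mult_iff)
  have orbit: "\<exists>r. closed_orbit N \<mu> r"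
    if "N \<in> {N0 - \<eta>..N0 + \<eta>}" "\<bar>\<mu>\<bar> \<le> \<delta>0" "H (N, \<mu>) = 0" for N \<mu>
  proof (rule \<delta>2[OF in_J[OF that(2)]])
    have "s \<noteq> 0" using H0(1) by (auto simp: H_def)
    then show "shoot N \<mu> = 0" using that by (simp add: H_def)
    show "\<bar>\<mu>\<bar> < \<delta>2" using that \<delta>0 by simp
    show "\<bar>N - N0\<bar> < \<delta>2" using that(1) \<eta> by auto
  qed
  have "\<exists>v r. global_solution (\<lambda>p. g (p, \<mu>)) U (R *\<^sub>R dir \<sigma> 0) v r \<and> periodic r" if "\<mu> \<in> {-\<delta>0<..<\<delta>0}" for \<mu>
  proof -
    have \<mu>: "\<bar>\<mu>\<bar> \<le> \<delta>0" using that by auto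
    have "continuous_on {N0 - \<eta>..N0 + \<eta>} (\<lambda>N. H (N, \<mu>))"
      by (rule continuous_on_compose2[OF H_cont]) (use in_J[OF \<mu>] in \<open>auto intro!: continuous_intros\<close>)
    then obtain N where "N0 - \<eta> \<le> N" "N \<le> N0 + \<eta>" "H (N, \<mu>) = 0"
      using IVT'[of "\<lambda>N. H (N, \<mu>)" "N0 - \<eta>" 0 "N0 + \<eta>"] left[OF \<mu>] right[OF \<mu>] \<eta>(1)
      by (auto simp: less_imp_le)
    then show ?thesis using orbit[of N \<mu>] \<mu> unfolding closed_orbit_def by auto
  qed
  moreover obtain Z where Z: "compact Z" "connected Z" "Z \<subseteq> {N0 - \<eta>..N0 + \<eta>} \<times> {0..\<delta>0}"
    "\<And>p. p \<in> Z \<Longrightarrow> H p = 0" "\<And>\<mu>. \<mu> \<in> {0..\<delta>0} \<Longrightarrow> \<exists>N. (N, \<mu>) \<in> Z"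
  proof -
    have "\<exists>V. compact V \<and> connected V \<and> V \<subseteq> {N0 - \<eta>..N0 + \<eta>} \<times> {0..\<delta>0} \<and> (\<forall>p\<in>V. H p = 0) \<and>
        (\<forall>\<mu>\<in>{0..\<delta>0}. \<exists>N. (N, \<mu>) \<in> V)"
    proof (rule zero_continuum)
      show "continuous_on ({N0 - \<eta>..N0 + \<eta>} \<times> {0..\<delta>0}) H"
      by (rule continuous_on_subset[OF H_cont]) (use in_J in auto)
    qed (use \<eta> \<delta>0 left right in auto)
    then show ?thesis using that by blast
  qed
  define V where "V = (\<lambda>p. ((inverse (sqrt (fst p)) * u0) *\<^sub>R ortho \<sigma> 0, snd p)) ` Z"
  have cont: "continuous_on Z (\<lambda>p. ((inverse (sqrt (fst p)) * u0) *\<^sub>R ortho \<sigma> 0, snd p))"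
    using Z(3) \<eta>(4) by (intro continuous_intros) auto
  have "compact V" "connected V"
    unfolding V_def using cont Z(1,2) by (auto intro: compact_continuous_image connected_continuous_image)
  moreover have "V \<subseteq> UNIV \<times> J" unfolding V_def using Z(3) in_J by force
  moreover have "\<forall>\<mu>\<in>{0..\<delta>0}. V \<inter> (UNIV \<times> {\<mu>}) \<noteq> {}"
    unfolding V_def using Z(5) by force
  moreover have "\<forall>(v, \<mu>)\<in>V. \<exists>r. global_solution (\<lambda>p. g (p, \<mu>)) U (R *\<^sub>R dir \<sigma> 0) v r \<and> periodic r \<and>
          simple_closed_curve (range r) \<and> reflect_x ` range r = range r \<and> encloses (range r) 0"
  proof -
    have "\<exists>r. closed_orbit N \<mu> r" if "(N, \<mu>) \<in> Z" for N \<mu>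
      using orbit[of N \<mu>] Z(3,4) that by force
    then show ?thesis unfolding V_def closed_orbit_def by auto
  qed
  ultimately show ?thesis using \<delta>0(1,5) by blast
qed

end

theorem mainTheorem4:
  fixes C U :: "(real^2) set" and x0 :: "real^2" and R a \<kappa> \<alpha> :: real
    and g :: "(real^2) \<times> real \<Rightarrow> real^2"
  assumes "R > 0" and "C = sphere 0 R"
    and "x0 \<in> C" and "x0 $ 2 = 0"
    and "open U" and "C \<subseteq> U" and "U \<subseteq> UNIV - {0}"
    and "a > 0"
    and "continuous_on (U \<times> {-a<..<a}) g"
    and "\<kappa> > 0" and "\<alpha> \<ge> 0" and "\<alpha> \<noteq> 1"
    and "\<And>p. p \<in> U \<Longrightarrow> g (p, 0) = - (\<kappa> / norm p powr (\<alpha> + 2)) *\<^sub>R p"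
    and "\<And>\<mu>. \<mu> \<in> {-a<..<a} \<Longrightarrow> C1_on (\<lambda>p. g (p, \<mu>)) U"
    and "reflect_x ` U = U"
    and "\<And>\<mu> p. \<mu> \<in> {-a<..<a} \<Longrightarrow> p \<in> U \<Longrightarrow> g (reflect_x p, \<mu>) = reflect_x (g (p, \<mu>))"
  shows "\<exists>\<delta>0. 0 < \<delta>0 \<and> \<delta>0 < a \<and>
    (\<forall>\<mu>\<in>{-\<delta>0<..<\<delta>0}. \<exists>v r. global_solution (\<lambda>p. g (p, \<mu>)) U x0 v r \<and> periodic r) \<and>
    (\<exists>V :: ((real^2) \<times> real) set.
       compact V \<and> connected V \<and> V \<subseteq> UNIV \<times> {-a<..<a} \<and>
       (\<forall>\<mu>\<in>{0..\<delta>0}. V \<inter> (UNIV \<times> {\<mu>}) \<noteq> {}) \<and>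
       (\<forall>(v, \<mu>)\<in>V. \<exists>r. global_solution (\<lambda>p. g (p, \<mu>)) U x0 v r \<and> periodic r \<and>
          simple_closed_curve (range r) \<and>
          reflect_x ` range r = range r \<and>
          encloses (range r) 0))"
proof -
  define \<sigma> where "\<sigma> = x0 $ 1 / R"
  have "(norm x0)\<^sup>2 = (x0 $ 1)\<^sup>2" using \<open>x0 $ 2 = 0\<close> by (simp only: norm_sq_2) simp
  then have "norm x0 = \<bar>x0 $ 1\<bar>" by (metis abs_norm_cancel real_sqrt_abs)
  then have "\<bar>x0 $ 1\<bar> = R" using assms(2,3) by simp
  then have \<sigma>: "\<bar>\<sigma>\<bar> = 1" using \<open>R > 0\<close> by (simp add: \<sigma>_def)
  have x0: "R *\<^sub>R dir \<sigma> 0 = x0"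
    using \<open>R > 0\<close> \<open>x0 $ 2 = 0\<close> by (simp add: vec_eq_iff forall_2 \<sigma>_def)
  have "compact (sphere (0 :: real^2) R)" by simp
  then obtain e where "0 < e" and e: "(\<Union>x\<in>sphere 0 R. cball x e) \<subseteq> U"
    using compact_subset_open_imp_cball_epsilon_subset[of "sphere 0 R" U] assms by blast
  have "isCont inverse (inverse R)" using \<open>R > 0\<close> by (intro continuous_intros) auto
  then obtain d where "0 < d" and d: "\<And>u. dist u (inverse R) < d \<Longrightarrow> dist (inverse u) R < e"
    using \<open>0 < e\<close> unfolding continuous_at_eps_delta inverse_inverse_eq by blast
  define \<rho> where "\<rho> = min d (inverse R) / 2"
  have \<rho>: "0 < \<rho>" "\<rho> < d" "\<rho> < inverse R"
    using \<open>0 < d\<close> \<open>R > 0\<close> by (auto simp: \<rho>_def min_def)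
  have annulus: "inverse u *\<^sub>R dir \<sigma> \<theta> \<in> U" if "u \<in> {inverse R - \<rho>..inverse R + \<rho>}" for u \<theta>
  proof -
    have "dist u (inverse R) < d" using that \<rho>(2) by (auto simp: dist_real_def)
    then have "\<bar>inverse u - R\<bar> < e" using d by (simp add: dist_real_def)
    moreover have "dist (R *\<^sub>R dir \<sigma> \<theta>) (inverse u *\<^sub>R dir \<sigma> \<theta>) = \<bar>inverse u - R\<bar>"
      by (simp add: dist_norm norm_dir[OF \<sigma>] abs_minus_commute flip: scaleR_diff_left)
    ultimately have "inverse u *\<^sub>R dir \<sigma> \<theta> \<in> cball (R *\<^sub>R dir \<sigma> \<theta>) e" by simp
    moreover have "R *\<^sub>R dir \<sigma> \<theta> \<in> sphere 0 R" using \<open>R > 0\<close> by (simp add: norm_dir[OF \<sigma>])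
    ultimately show ?thesis using e by blast
  qed
  interpret reversible_perturbation g U \<sigma> R a \<kappa> \<alpha> \<rho>
    by unfold_locales (use assms \<sigma> \<rho> annulus in auto)
  show ?thesis using closed_orbit_continuum unfolding x0 .
qed

end
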